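(* Let $\{\mathrm{FT}_n(\mu):n=1,2,\ldots\}$ denote a sequence of locally overdispersed or underdispersed factorial tilting families having local dispersion functions $v_n$ with domains $\Psi_n$. Suppose that 1. $\bigcap_{n=1}^\infty\Psi_n$ contains a non-empty interval $\Psi_0$; 2. $\lim_{n\to\infty}v_n(\mu)=v(\mu)$ exists uniformly on compact subsets of $\mathrm{int}\,\Psi_0$; 3. $v(\mu)\ne0$ for all $\mu\in\mathrm{int}\,\Psi_0$ or $v(\mu)=0$ for all $\mu\in\mathrm{int}\,\Psi_0$. In the case $v(\mu)\neq0$, there exists a factorial tilting family $\mathrm{FT}(\mu)$ whose local dispersion function coincides with $v$ on $\mathrm{int}\,\Psi_0$, such that for each $\mu$ in $\mathrm{int}\,\Psi_0$ the sequence of distributions $\mathrm{FT}_n(\mu)$ converges weakly to $\mathrm{FT}(\mu)$. In the case $v(\mu)=0$, $\mathrm{FT}_n(\mu)$ converges weakly for each $\mu$ in $\mathrm{int}\,\Psi_0$ to the Poisson distribution $\mathrm{Po}(\mu)$.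
   Context: The factorial cumulant generating function (FCGF) of a random variable $X$ is $C(t)=C(t;X)=\log\mathrm{E}[(1+t)^X]$ for $t>-1$, with $\mathrm{dom}(C)=\{t>-1:C(t)<\infty\}$. $\mathcal{C}$ is the set of FCGFs with $\mathrm{int}(\mathrm{dom}(C))\ne\emptyset$; equalities between FCGFs are understood to hold in a neighbourhood of zero. Tilting: let $\overline{\mathcal{K}}$ be the set of real analytic functions $K:\mathrm{dom}(K)\to\mathbb{R}$ with $0\in\mathrm{dom}(K)$, $K(0)=0$, where $\mathrm{dom}(K)$ is the largest interval containing zero on which $K$ is analytic. The tilting of $K$ by $\theta\in\mathrm{dom}(K)$ is $K_\theta(t)=K(\theta+t)-K(\theta)$. This defines an equivalence relation; its equivalence classes within $\mathcal{C}$ are called factorial tilting families (generated by $C$: $\{C_\theta\in\mathcal{C}:\theta\in\mathrm{dom}(C)\}$). Local dispersion function: let $\Theta_0\subseteq\mathrm{dom}(C)$ be a non-degenerate interval on which $\ddot C$ has constant nonzero sign (positive: locally overdispersed; negative: locally underdispersed), so that $\dot C$ is strictly monotone on $\Theta_0$. The family is then parametrized locally by the mean $\mu=\dot C(\theta)\in\dot C(\Theta_0)$, the distribution with FCGF $C_\theta$ being denoted $\mathrm{FT}(\mu)$. The local dispersion function, with domain $\dot C(\Theta_0)$, is $v(\mu)=\ddot C\circ\dot C^{-1}(\mu)$ (defined by continuity at endpoints belonging to the domain); it gives the dispersion (variance minus mean) of $\mathrm{FT}(\mu)$. $\mathrm{Po}(\mu)$ is the Poisson distribution with mean $\mu\ge0$,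 with FCGF $t\mapsto\mu t$. *)

theory Defs
  imports "HOL-Probability.Probability"
begin

text \<open>A random variable is represented by its law, a \<^const>\<open>real_distribution\<close>.  It is not assumed
  to be integer-valued.\<close>

definition fcgf_dom :: "real measure \<Rightarrow> real set" where
  "fcgf_dom M = {t. t > -1 \<and> integrable M (\<lambda>x. (1 + t) powr x)}"

text \<open>Meaningful for \<open>t \<in> fcgf_dom M\<close> only.\<close>

definition fcgf :: "real measure \<Rightarrow> real \<Rightarrow> real" where
  "fcgf M t = ln (\<integral>x. (1 + t) powr x \<partial>M)"

definition real_analytic_at :: "(real \<Rightarrow> real) \<Rightarrow> real \<Rightarrow> bool" where
  "real_analytic_at f x \<longleftrightarrow>
     (\<exists>a r. r > 0 \<and> (\<forall>y. \<bar>y - x\<bar> < r \<longrightarrow> (\<lambda>k. a k * (y - x) ^ k) sums f y))"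

text \<open>A non-degenerate interval containing zero on which \<open>K\<close> is analytic.  At an endpoint belonging
  to the interval, which may be zero itself, this means continuity from inside the interval; so the
  FCGFs that are finite at an endpoint of their effective domain are covered there too.\<close>

definition analytic_interval :: "(real \<Rightarrow> real) \<Rightarrow> real set \<Rightarrow> bool" where
  "analytic_interval K I \<longleftrightarrow> is_interval I \<and> interior I \<noteq> {} \<and> 0 \<in> I \<and>
     continuous_on I K \<and> (\<forall>x \<in> interior I. real_analytic_at K x)"

text \<open>The largest such interval.  \<open>K\<close> is total, and its values outside \<open>analytic_dom K\<close> carry no
  meaning.  The union fails to be such an interval only if there is none, or if \<open>K\<close> is continuous but
  not analytic at zero and is analytic on both sides of it; \<open>analytic_funs\<close> excludes both.\<close>

definition analytic_dom :: "(real \<Rightarrow> real) \<Rightarrow> real set" where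
  "analytic_dom K = \<Union> {I. analytic_interval K I}"

definition analytic_funs :: "(real \<Rightarrow> real) set" where
  "analytic_funs = {K. analytic_interval K (analytic_dom K) \<and> K 0 = 0}"

definition tilt :: "(real \<Rightarrow> real) \<Rightarrow> real \<Rightarrow> real \<Rightarrow> real" where
  "tilt K \<theta> t = K (\<theta> + t) - K \<theta>"

text \<open>\<open>K\<close> is the FCGF of the law \<open>M\<close>.  Equality of FCGFs is equality near zero, so
  \<open>analytic_dom K\<close> may be larger than \<open>fcgf_dom M\<close>; for instance it may extend below \<open>-1\<close>.\<close>

definition has_fcgf :: "real measure \<Rightarrow> (real \<Rightarrow> real) \<Rightarrow> bool" where
  "has_fcgf M K \<longleftrightarrow> real_distribution M \<and> interior (fcgf_dom M) \<noteq> {} \<and>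
     (\<forall>\<^sub>F t in at 0 within analytic_dom K. t \<in> fcgf_dom M \<and> K t = fcgf M t)"

definition fcgfs :: "(real \<Rightarrow> real) set" where
  "fcgfs = {K \<in> analytic_funs. \<exists>M. has_fcgf M K}"

definition tilting_family :: "(real \<Rightarrow> real) \<Rightarrow> (real \<Rightarrow> real) set" where
  "tilting_family C = {tilt C \<theta> | \<theta>. \<theta> \<in> analytic_dom C \<and> tilt C \<theta> \<in> fcgfs}"

text \<open>\<open>C1\<close> and \<open>C2\<close> are the first and second derivatives of \<open>C\<close> on the interval \<open>\<Theta>\<close>, defined by
  continuity at those endpoints of \<open>\<Theta>\<close> that belong to it, and \<open>C2\<close> has constant nonzero sign.\<close>

definition locally_dispersed ::
    "(real \<Rightarrow> real) \<Rightarrow> real set \<Rightarrow> (real \<Rightarrow> real) \<Rightarrow> (real \<Rightarrow> real) \<Rightarrow> bool" where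
  "locally_dispersed C \<Theta> C1 C2 \<longleftrightarrow>
     is_interval \<Theta> \<and> interior \<Theta> \<noteq> {} \<and> \<Theta> \<subseteq> analytic_dom C \<and>
     continuous_on \<Theta> C1 \<and> continuous_on \<Theta> C2 \<and>
     (\<forall>\<theta> \<in> interior \<Theta>. C1 \<theta> = deriv C \<theta> \<and> C2 \<theta> = deriv (deriv C) \<theta>) \<and>
     ((\<forall>\<theta> \<in> \<Theta>. C2 \<theta> > 0) \<or> (\<forall>\<theta> \<in> \<Theta>. C2 \<theta> < 0))"

text \<open>\<open>FT\<close> is a locally over- or underdispersed factorial tilting family, parametrized by the mean
  \<open>\<mu> \<in> \<Psi>\<close>, and \<open>v\<close> is its local dispersion function with domain \<open>\<Psi>\<close>.  Since \<open>C1\<close> is injective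
  on \<open>\<Theta>\<close>, the last conjunct says that \<open>v = C2 \<circ> C1\<^sup>-\<^sup>1\<close> on \<open>\<Psi>\<close>.  Not every \<open>tilt C \<theta>\<close> is an FCGF;
  that it is one for \<open>\<theta> \<in> \<Theta>\<close> is what makes \<open>FT \<mu>\<close> a distribution for each \<open>\<mu> \<in> \<Psi>\<close>.\<close>

definition local_tilting_family ::
    "(real \<Rightarrow> real measure) \<Rightarrow> real set \<Rightarrow> (real \<Rightarrow> real) \<Rightarrow> bool" where
  "local_tilting_family FT \<Psi> v \<longleftrightarrow>
     (\<exists>C \<Theta> C1 C2. C \<in> fcgfs \<and> locally_dispersed C \<Theta> C1 C2 \<and> \<Psi> = C1 ` \<Theta> \<and>
        (\<forall>\<theta> \<in> \<Theta>. tilt C \<theta> \<in> tilting_family C \<and> has_fcgf (FT (C1 \<theta>)) (tilt C \<theta>)) \<and>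
        (\<forall>\<theta> \<in> \<Theta>. v (C1 \<theta>) = C2 \<theta>))"

text \<open>\<^const>\<open>poisson_pmf\<close> is specified for positive rates only; the Poisson distribution with mean zero
  is the point mass at zero.  Only used for \<open>\<mu> \<ge> 0\<close>.\<close>

definition poisson_law :: "real \<Rightarrow> real measure" where
  "poisson_law \<mu> =
     distr (measure_pmf (if \<mu> = 0 then return_pmf 0 else poisson_pmf \<mu>)) borel real"

end

theory Submission
  imports Defs "HOL-Complex_Analysis.Complex_Analysis"
begin

text \<open>Write \<open>C\<^sub>n\<close> for the function that generates the \<open>n\<close>-th family and \<open>\<theta>\<^sub>n\<close> for the parameter
  with \<open>C\<^sub>n'(\<theta>\<^sub>n) = \<mu>\<close>.  The law \<open>FT\<^sub>n(\<mu>)\<close> has the FCGF \<open>K\<^sub>n(t) = C\<^sub>n(\<theta>\<^sub>n + t) - C\<^sub>n(\<theta>\<^sub>n)\<close>, and the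
  mean \<open>K\<^sub>n'\<close> along the family solves the differential equation \<open>x' = v\<^sub>n(x)\<close>, \<open>x(0) = \<mu>\<close>.  Since
  \<open>v\<^sub>n \<rightarrow> v\<close> uniformly near \<open>\<mu>\<close>, these solutions live on a common interval around zero and converge
  there to the solution of \<open>x' = v(x)\<close>.  No Lipschitz condition on \<open>v\<close> is available, but the
  equation is autonomous: if \<open>\<psi>' = 1 / v\<close>, then \<open>\<psi>(K\<^sub>n'(t)) - t\<close> has derivative
  \<open>v\<^sub>n / v - 1\<close>, which is uniformly small.  If \<open>v = 0\<close>, the identity takes the place
  of \<open>\<psi>\<close>, and \<open>K\<^sub>n' \<rightarrow> \<mu>\<close>.  Either way \<open>K\<^sub>n \<rightarrow> K\<close> on a fixed interval
  (\<open>tilt_near_ode_solution\<close>).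

  The function \<open>K\<^sub>n\<close> is known to be the logarithm of \<open>E((1 + t)\<^sup>X)\<close> only in a neighbourhood of zero
  that may shrink with \<open>n\<close>.  The substitution \<open>t = e\<^sup>s - 1\<close> turns this expectation into the Laplace
  transform \<open>E(e\<^bsup>sX\<^esup>)\<close> of a positive measure, and such a transform has a singularity at each finite real
  end of its interval of convergence (\<open>mgf_finite_on_disc_of_holomorphy\<close>).  Hence
  the expectation is finite and equal to \<open>exp K\<^sub>n\<close> on every interval \<open>(-d, d)\<close> with \<open>d \<le> 1\<close> on which
  \<open>K\<^sub>n\<close> is analytic (\<open>fcgf_eq_analytic_continuation\<close>).  So the Laplace transforms of \<open>FT\<^sub>n(\<mu>)\<close> converge in a fixed
  neighbourhood of zero, and the continuity theorem \<open>mgf_continuity\<close> yields a weak limit whose FCGF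
  is \<open>K\<close> near zero.

  If \<open>v = 0\<close> then \<open>K(t) = \<mu> t\<close>, which identifies the limit as Poisson.  If \<open>v \<noteq> 0\<close>, a single
  function \<open>C\<close> with \<open>C' = \<psi>\<^sup>-\<^sup>1\<close> serves for all \<open>\<mu>\<close>: the limit for \<open>\<mu>\<close> has the FCGF
  \<open>C(\<psi>(\<mu>) + t) - C(\<psi>(\<mu>))\<close>.  The analyticity of \<open>C\<close>, which a merely continuous \<open>v\<close> does not give,
  comes from the existence of these limit laws, because FCGFs are analytic inside their domains.\<close>

section \<open>Real analytic functions\<close>

text \<open>Real power series are handled through holomorphic functions on complex discs, which makes closure
  under composition, differentiation and re-expansion at other points immediate.  Taking the real
  part here spares the proof that the extension is real on the real axis.\<close>

lemma real_analytic_at_if_Re_holomorphic: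
  assumes hol: "F holomorphic_on ball (complex_of_real x) r" and r: "r > 0"
    and eq: "\<And>y. \<bar>y - x\<bar> < r \<Longrightarrow> f y = Re (F (of_real y))"
  shows "real_analytic_at f x"
  unfolding real_analytic_at_def
proof (intro exI conjI allI impI)
  fix y :: real
  assume y: "\<bar>y - x\<bar> < r"
  have "of_real y \<in> ball (complex_of_real x) r"
    using y by (simp add: dist_of_real dist_real_def abs_minus_commute)
  from holomorphic_power_series[OF hol this]
  have "(\<lambda>n. Re ((deriv ^^ n) F (of_real x) / fact n * (of_real y - of_real x) ^ n))
      sums Re (F (of_real y))"
    by (rule sums_Re)
  moreover have "Re (c * (of_real y - of_real x) ^ n) = Re c * (y - x) ^ n" for c :: complex and n
    by (simp flip: of_real_diff of_real_power)
  ultimately show "(\<lambda>n. Re ((deriv ^^ n) F (of_real x) / fact n) * (y - x) ^ n) sums f y"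
    using eq[OF y] by (simp only:)
qed (fact r)

lemma real_analytic_at_holomorphic_extension:
  assumes "real_analytic_at f x"
  obtains F r where "r > 0" "F holomorphic_on ball (complex_of_real x) r"
    "\<And>y. \<bar>y - x\<bar> < r \<Longrightarrow> F (of_real y) = of_real (f y)"
proof -
  obtain a r where r: "r > 0"
    and sums: "\<And>y. \<bar>y - x\<bar> < r \<Longrightarrow> (\<lambda>k. a k * (y - x) ^ k) sums f y"
    using assms unfolding real_analytic_at_def by metis
  define F where "F z = (\<Sum>k. complex_of_real (a k) * (z - of_real x) ^ k)" for z
  have F: "(\<lambda>k. complex_of_real (a k) * (z - of_real x) ^ k) sums F z"
    if z: "z \<in> ball (complex_of_real x) r" for z
  proof -
    obtain \<rho> where \<rho>: "cmod (z - of_real x) < \<rho>" "\<rho> < r"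
      using z dense by (metis dist_commute dist_norm mem_ball)
    have "0 < \<rho>" using \<rho>(1) norm_ge_zero le_less_trans by blast
    then have "summable (\<lambda>k. a k * ((x + \<rho>) - x) ^ k)"
      using sums[of "x + \<rho>"] \<rho> by (auto simp: sums_iff)
    then have "summable (\<lambda>k. complex_of_real (a k) * of_real \<rho> ^ k)"
      using summable_of_real[of "\<lambda>k. a k * \<rho> ^ k", where 'a = complex] by simp
    then have "summable (\<lambda>k. complex_of_real (a k) * (z - of_real x) ^ k)"
      by (rule powser_inside) (use \<rho>(1) \<open>0 < \<rho>\<close> in simp)
    then show ?thesis unfolding F_def by (rule summable_sums)
  qed
  have "F (of_real y) = of_real (f y)" if "\<bar>y - x\<bar> < r" for y
  proof -
    have "(\<lambda>k. complex_of_real (a k * (y - x) ^ k)) sums of_real (f y)"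
      using sums[OF that] by (simp only: sums_of_real_iff)
    moreover have "of_real y \<in> ball (complex_of_real x) r"
      using that by (simp add: dist_of_real dist_real_def abs_minus_commute)
    ultimately show ?thesis using F[of "of_real y"] by (simp add: sums_iff)
  qed
  moreover have "F holomorphic_on ball (complex_of_real x) r"
    by (rule power_series_holomorphic[OF F])
  ultimately show ?thesis using r that by blast
qed

lemma real_analytic_at_derivs:
  assumes "real_analytic_at f x"
  shows "real_analytic_at (deriv f) x" and "f field_differentiable at x"
proof -
  obtain F r where r: "r > 0" and hol: "F holomorphic_on ball (complex_of_real x) r"
    and F: "\<And>y. \<bar>y - x\<bar> < r \<Longrightarrow> F (of_real y) = of_real (f y)"
    using real_analytic_at_holomorphic_extension[OF assms] by blast
  have D: "(f has_real_derivative Re (deriv F (of_real y))) (at y)" if y: "\<bar>y - x\<bar> < r" for y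
  proof -
    have "of_real y \<in> ball (complex_of_real x) r"
      using y by (simp add: dist_of_real dist_real_def abs_minus_commute)
    then have "(F has_field_derivative deriv F (of_real y)) (at (of_real y))"
      using hol holomorphic_derivI[OF hol] by simp
    then have "((\<lambda>u. Re (F (of_real u))) has_vector_derivative Re (deriv F (of_real y))) (at y)"
      by (intro bounded_linear.has_vector_derivative[OF bounded_linear_Re]
          has_vector_derivative_real_field)
    then have "((\<lambda>u. Re (F (of_real u))) has_real_derivative Re (deriv F (of_real y))) (at y)"
      by (simp add: has_real_derivative_iff_has_vector_derivative)
    moreover have "\<forall>\<^sub>F u in nhds y. \<bar>u - x\<bar> < r"
      using y by (intro eventually_nhds_in_open[of "{u. \<bar>u - x\<bar> < r}", simplified])
        (auto intro!: open_Collect_less continuous_intros)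
    then have "\<forall>\<^sub>F u in nhds y. Re (F (of_real u)) = f u"
      by eventually_elim (simp add: F)
    ultimately show ?thesis
      by (simp cong: DERIV_cong_ev)
  qed
  show "f field_differentiable at x"
    using D[of x] r by (auto simp: field_differentiable_def)
  show "real_analytic_at (deriv f) x"
  proof (rule real_analytic_at_if_Re_holomorphic[OF _ r])
    show "deriv F holomorphic_on ball (complex_of_real x) r"
      using hol by (intro holomorphic_deriv) auto
    show "deriv f y = Re (deriv F (of_real y))" if "\<bar>y - x\<bar> < r" for y
      using D[OF that] by (rule DERIV_imp_deriv)
  qed
qed

lemma real_analytic_at_nearby:
  assumes "real_analytic_at f x"
  obtains r where "r > 0" "\<And>y. \<bar>y - x\<bar> < r \<Longrightarrow> real_analytic_at f y"
proof -
  obtain F r where r: "r > 0" and hol: "F holomorphic_on ball (complex_of_real x) r"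
    and F: "\<And>y. \<bar>y - x\<bar> < r \<Longrightarrow> F (of_real y) = of_real (f y)"
    using real_analytic_at_holomorphic_extension[OF assms] by blast
  have "real_analytic_at f y" if y: "\<bar>y - x\<bar> < r" for y
  proof (rule real_analytic_at_if_Re_holomorphic)
    have "ball (complex_of_real y) (r - \<bar>y - x\<bar>) \<subseteq> ball (complex_of_real x) r"
      by (intro ball_subset_ball_iff[THEN iffD2] disjI1) (simp add: dist_of_real dist_real_def)
    then show "F holomorphic_on ball (complex_of_real y) (r - \<bar>y - x\<bar>)"
      using hol holomorphic_on_subset by blast
    show "f u = Re (F (of_real u))" if "\<bar>u - y\<bar> < r - \<bar>y - x\<bar>" for u
    proof -
      have "\<bar>u - x\<bar> \<le> \<bar>u - y\<bar> + \<bar>y - x\<bar>" by linarith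
      then show ?thesis using F[of u] that by simp
    qed
  qed (use y in simp)
  then show ?thesis using r that by blast
qed

lemma real_analytic_at_shift:
  assumes "real_analytic_at f (x + a)"
  shows "real_analytic_at (\<lambda>y. f (y + a) + b) x"
proof -
  obtain c r where r: "r > 0"
    and c: "\<And>y. \<bar>y - (x + a)\<bar> < r \<Longrightarrow> (\<lambda>k. c k * (y - (x + a)) ^ k) sums f y"
    using assms unfolding real_analytic_at_def by blast
  have "(\<lambda>k. (c k + (if k = 0 then b else 0)) * (y - x) ^ k) sums (f (y + a) + b)"
    if "\<bar>y - x\<bar> < r" for y
  proof -
    have "(\<lambda>k. c k * (y - x) ^ k) sums f (y + a)" using c[of "y + a"] that by simp
    from sums_add[OF this sums_single[of 0 "\<lambda>_. b"]]
    have "(\<lambda>k. c k * (y - x) ^ k + (if k = 0 then b else 0)) sums (f (y + a) + b)" .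
    moreover have "c k * (y - x) ^ k + (if k = 0 then b else 0)
        = (c k + (if k = 0 then b else 0)) * (y - x) ^ k" for k
      by (simp add: distrib_right)
    ultimately show ?thesis by (simp only:)
  qed
  then show ?thesis
    unfolding real_analytic_at_def
    by (intro exI[of _ "\<lambda>k. c k + (if k = 0 then b else 0)"] exI[of _ r] conjI allI impI r)
qed

lemma real_analytic_at_tilt: "real_analytic_at K (\<theta> + t) \<Longrightarrow> real_analytic_at (tilt K \<theta>) t"
  using real_analytic_at_shift[of K t \<theta> "- K \<theta>"]
  by (simp add: tilt_def[abs_def] add.commute)

lemma real_analytic_at_if_tilt: "real_analytic_at (tilt K \<theta>) 0 \<Longrightarrow> real_analytic_at K \<theta>"
  using real_analytic_at_shift[of "tilt K \<theta>" \<theta> "- \<theta>" "K \<theta>"]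
  by (simp add: tilt_def)

lemma real_analytic_at_imp_isCont: "real_analytic_at f x \<Longrightarrow> isCont f x"
  using real_analytic_at_derivs(2) field_differentiable_imp_continuous_at by blast

lemma analytic_interval_open:
  assumes "open I" "is_interval I" "0 \<in> I" "\<And>x. x \<in> I \<Longrightarrow> real_analytic_at K x"
  shows "analytic_interval K I"
  unfolding analytic_interval_def using assms
  by (auto simp: interior_open intro!: continuous_at_imp_continuous_on real_analytic_at_imp_isCont)

lemma analytic_interval_subset_dom: "analytic_interval K I \<Longrightarrow> I \<subseteq> analytic_dom K"
  by (auto simp: analytic_dom_def)

text \<open>Every analytic interval contains zero, so the union \<open>D\<close> of all of them is an interval, and an
  interior point of \<open>D\<close> other than zero is interior to one of them, namely to one that reaches
  beyond it.  Zero is the only point where the pieces on the two sides could fail to fit, and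
  analyticity there is assumed.\<close>

lemma analytic_funs_if_analytic_at_zero:
  assumes an: "real_analytic_at K 0" and K0: "K 0 = 0"
  shows "K \<in> analytic_funs"
proof -
  let ?D = "analytic_dom K"
  obtain r where r: "r > 0" "\<And>y. \<bar>y - 0\<bar> < r \<Longrightarrow> real_analytic_at K y"
    using real_analytic_at_nearby[OF an] by blast
  have "analytic_interval K (ball 0 r)"
    using r by (intro analytic_interval_open) (auto simp: is_interval_ball_real dist_real_def)
  then have ball: "ball 0 r \<subseteq> ?D" by (rule analytic_interval_subset_dom)
  then have "0 \<in> interior ?D" using r(1) interior_maximal[OF ball] by auto
  then have zero: "0 \<in> ?D" "interior ?D \<noteq> {}" using interior_subset by auto
  have mem: "\<exists>I. analytic_interval K I \<and> y \<in> I \<and> closed_segment 0 y \<subseteq> I" if "y \<in> ?D" for y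
  proof -
    obtain I where I: "analytic_interval K I" "y \<in> I" using \<open>y \<in> ?D\<close> by (auto simp: analytic_dom_def)
    then have "closed_segment 0 y \<subseteq> I"
      by (intro closed_segment_subset) (auto simp: analytic_interval_def is_interval_convex_1)
    then show ?thesis using I by blast
  qed
  have seg: "closed_segment 0 y \<subseteq> ?D" if "y \<in> ?D" for y
    using mem[OF that] analytic_interval_subset_dom by blast
  have "is_interval ?D"
    unfolding is_interval_1
  proof (intro ballI allI impI)
    fix a b x assume "a \<in> ?D" "b \<in> ?D" "a \<le> x \<and> x \<le> b"
    then show "x \<in> ?D"
      using seg[of a] seg[of b] by (cases "x \<ge> 0") (auto simp: closed_segment_eq_real_ivl subset_eq)
  qed
  moreover have analytic: "real_analytic_at K x" if x: "x \<in> interior ?D" for x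
  proof (cases "x = 0")
    case False
    obtain e where e: "e > 0" "ball x e \<subseteq> ?D" using x by (meson mem_interior)
    define y where "y = x + sgn x * (e / 2)"
    have "\<bar>y - x\<bar> < e" using e(1) by (simp add: y_def abs_mult abs_sgn_eq False)
    then have "y \<in> ?D" using e(2) by (auto simp: dist_real_def abs_minus_commute)
    then obtain I where I: "analytic_interval K I" "closed_segment 0 y \<subseteq> I" using mem by blast
    have "x \<in> open_segment 0 y"
      using False e(1) by (cases x "0::real" rule: linorder_cases)
        (auto simp: open_segment_eq_real_ivl y_def)
    then have "x \<in> interior I"
      using I(2) open_segment_eq_real_ivl[of 0 y] segment_open_subset_closed[of 0 y]
      by (intro interiorI[of "open_segment 0 y"]) auto
    then show ?thesis using I(1) by (auto simp: analytic_interval_def)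
  qed (simp add: an)
  moreover have "continuous_on ?D K"
    unfolding continuous_on_eq_continuous_within
  proof
    fix x assume x: "x \<in> ?D"
    show "continuous (at x within ?D) K"
    proof (cases "x \<in> interior ?D")
      case True
      then show ?thesis
        using analytic real_analytic_at_imp_isCont continuous_at_imp_continuous_at_within by blast
    next
      case False
      obtain I where I: "analytic_interval K I" "x \<in> I" "closed_segment 0 x \<subseteq> I" using mem[OF x] by blast
      have "x \<noteq> 0" using False \<open>0 \<in> interior ?D\<close> by auto
      have beyond: "y \<in> closed_segment 0 x" if y: "y \<in> ?D" "y * x > 0" for y
      proof (rule ccontr)
        assume "y \<notin> closed_segment 0 x"
        then have "x \<in> open_segment 0 y"
          using y(2) \<open>x \<noteq> 0\<close> by (cases "x > 0")
            (auto simp: open_segment_eq_real_ivl closed_segment_eq_real_ivl zero_less_mult_iff)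
        then have "x \<in> interior ?D"
          using seg[OF y(1)] open_segment_eq_real_ivl[of 0 y] segment_open_subset_closed[of 0 y]
          by (intro interiorI[of "open_segment 0 y"]) auto
        then show False using False by simp
      qed
      have "at x within ?D = at x within I"
      proof (rule at_within_nhd[of x "{y. y * x > 0}"])
        show "open {y. y * x > 0}" by (intro open_Collect_less continuous_intros)
        show "?D \<inter> {y. y * x > 0} - {x} = I \<inter> {y. y * x > 0} - {x}"
          using beyond I(3) analytic_interval_subset_dom[OF I(1)] by blast
        show "x \<in> {y. y * x > 0}" using \<open>x \<noteq> 0\<close> by (simp add: zero_less_mult_iff) linarith
      qed
      then show ?thesis
        using I(1,2) by (simp add: analytic_interval_def continuous_on_eq_continuous_within)
    qed
  qed
  ultimately show ?thesis
    using zero K0 by (simp add: analytic_funs_def analytic_interval_def)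
qed

section \<open>Laplace transforms of probability measures\<close>

lemma exp_le_exp_add_exp:
  fixes x s h a :: real
  assumes "\<bar>a\<bar> \<le> h"
  shows "exp (s * x) * exp (\<bar>x\<bar> * \<bar>a\<bar>) \<le> exp ((s + h) * x) + exp ((s - h) * x)"
proof -
  have "\<bar>x\<bar> * \<bar>a\<bar> \<le> \<bar>x\<bar> * h" using assms by (intro mult_left_mono) auto
  also have "exp (\<bar>x\<bar> * h) \<le> exp (h * x) + exp (- h * x)"
    by (cases "x \<ge> 0") (auto simp: mult.commute add_increasing add_increasing2)
  finally have "exp (s * x) * exp (\<bar>x\<bar> * \<bar>a\<bar>) \<le> exp (s * x) * (exp (h * x) + exp (- h * x))"
    by (simp add: exp_le_cancel_iff)
  also have "\<dots> = exp ((s + h) * x) + exp ((s - h) * x)"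
    by (simp add: distrib_left distrib_right left_diff_distrib flip: exp_add)
  finally show ?thesis .
qed

text \<open>The terms of the series of \<open>exp (z * x)\<close> around \<open>w\<close> add up in modulus to at most
  \<open>exp ((s + h) * x) + exp ((s - h) * x)\<close>, so dominated convergence allows termwise integration.\<close>

lemma laplace_power_series:
  fixes M :: "real measure" and s h :: real and w z :: complex
  assumes M: "real_distribution M"
    and int: "integrable M (\<lambda>x. exp ((s + h) * x))" "integrable M (\<lambda>x. exp ((s - h) * x))"
    and w: "Re w = s" and z: "cmod (z - w) \<le> h"
  shows "(\<lambda>k. (\<integral>x. of_real x ^ k * exp (w * of_real x) \<partial>M) / fact k * (z - w) ^ k)
           sums (\<integral>x. exp (z * of_real x) \<partial>M)"
proof -
  interpret real_distribution M by fact
  define f where "f k x = of_real x ^ k * exp (w * of_real x) / fact k * (z - w) ^ k" for k x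
  define S where "S n x = (\<Sum>k<n. f k x)" for n x
  define W where "W x = exp ((s + h) * x) + exp ((s - h) * x)" for x
  have W: "integrable M W" unfolding W_def by (intro Bochner_Integration.integrable_add int)
  have meas [measurable]: "f k \<in> borel_measurable M" for k
    unfolding f_def by measurable
  have f_eq: "f k x = exp (w * of_real x) * ((of_real x * (z - w)) ^ k /\<^sub>R fact k)" for k x
    by (simp add: f_def power_mult_distrib scaleR_conv_of_real divide_simps)
  have norm_f: "norm (f k x) = exp (s * x) * ((\<bar>x\<bar> * cmod (z - w)) ^ k /\<^sub>R fact k)" for k x
    unfolding f_eq by (simp add: norm_mult norm_power w power_mult_distrib)
  have lim: "(\<lambda>n. S n x) \<longlonglongrightarrow> exp (z * of_real x)" for x
  proof -
    have "(\<lambda>k. f k x) sums (exp (w * of_real x) * exp (of_real x * (z - w)))"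
      unfolding f_eq by (intro sums_mult exp_converges)
    also have "exp (w * of_real x) * exp (of_real x * (z - w)) = exp (z * of_real x)"
      by (simp flip: exp_add add: algebra_simps)
    finally show ?thesis by (simp add: sums_def S_def)
  qed
  have sum_bound: "(\<Sum>k<n. norm (f k x)) \<le> W x" for n x
  proof -
    have s: "(\<lambda>k. norm (f k x)) sums (exp (s * x) * exp (\<bar>x\<bar> * cmod (z - w)))"
      unfolding norm_f by (intro sums_mult exp_converges)
    then have "(\<Sum>k<n. norm (f k x)) \<le> exp (s * x) * exp (\<bar>x\<bar> * cmod (z - w))"
      by (metis norm_ge_zero sum_le_suminf sums_iff finite_lessThan)
    also have "\<dots> \<le> W x" using exp_le_exp_add_exp[of "cmod (z - w)" h s x] z by (simp add: W_def)
    finally show ?thesis .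
  qed
  have bound: "norm (S n x) \<le> W x" for n x
    unfolding S_def by (rule order_trans[OF norm_sum sum_bound])
  have int_f: "integrable M (f k)" for k
  proof (rule Bochner_Integration.integrable_bound[OF W])
    have "norm (f k x) \<le> (\<Sum>k<Suc k. norm (f k x))" for x
      by (intro member_le_sum) auto
    then show "AE x in M. norm (f k x) \<le> norm (W x)"
      using sum_bound order_trans by (metis (mono_tags, lifting) AE_I2 abs_ge_self real_norm_def)
  qed simp
  have "(\<lambda>n. integral\<^sup>L M (S n)) \<longlonglongrightarrow> (\<integral>x. exp (z * of_real x) \<partial>M)"
    by (rule integral_dominated_convergence[where w = W])
      (use lim bound W in \<open>auto simp: S_def[abs_def]\<close>)
  moreover have "integral\<^sup>L M (S n) =
      (\<Sum>k<n. (\<integral>x. of_real x ^ k * exp (w * of_real x) \<partial>M) / fact k * (z - w) ^ k)" for n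
  proof -
    have "integral\<^sup>L M (S n) = (\<Sum>k<n. integral\<^sup>L M (f k))"
      unfolding S_def by (rule Bochner_Integration.integral_sum) (rule int_f)
    then show ?thesis by (simp add: f_def[abs_def])
  qed
  ultimately show ?thesis by (simp add: sums_def)
qed

lemma laplace_holomorphic:
  fixes M :: "real measure"
  assumes M: "real_distribution M" and e: "e > 0"
    and int: "\<And>u. \<bar>u - s\<bar> < e \<Longrightarrow> integrable M (\<lambda>x. exp (u * x))"
  shows "(\<lambda>z. \<integral>x. exp (z * of_real x) \<partial>M) holomorphic_on {z. \<bar>Re z - s\<bar> < e}"
proof -
  have op: "open {z. \<bar>Re z - s\<bar> < e}"
    by (intro open_Collect_less continuous_intros)
  show ?thesis
    unfolding holomorphic_on_open[OF op]
  proof safe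
    fix z :: complex
    assume z: "\<bar>Re z - s\<bar> < e"
    define h where "h = (e - \<bar>Re z - s\<bar>) / 2"
    have h: "h > 0" "h < e - \<bar>Re z - s\<bar>" using z by (auto simp: h_def)
    have "(\<lambda>z. \<integral>x. exp (z * of_real x) \<partial>M) holomorphic_on ball z h"
    proof (rule power_series_holomorphic)
      fix w assume "w \<in> ball z h"
      then have "cmod (w - z) \<le> h" by (simp add: dist_norm norm_minus_commute)
      then show "(\<lambda>k. (\<integral>x. of_real x ^ k * exp (z * of_real x) \<partial>M) / fact k * (w - z) ^ k)
          sums (\<integral>x. exp (w * of_real x) \<partial>M)"
        using h by (intro laplace_power_series[OF M, of "Re z" h]) (auto intro!: int)
    qed
    then show "\<exists>f'. ((\<lambda>z. \<integral>x. exp (z * of_real x) \<partial>M) has_field_derivative f') (at z)"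
      using h(1) by (meson centre_in_ball holomorphic_derivI open_ball)
  qed
qed

lemma laplace_of_real:
  "(\<integral>x. exp (complex_of_real s * of_real x) \<partial>M) = of_real (\<integral>x. exp (s * x) \<partial>M)"
  by (simp only: exp_of_real integral_complex_of_real flip: of_real_mult)

lemma holomorphic_eq_if_eq_on_reals:
  assumes hol: "f holomorphic_on S" "g holomorphic_on S" and S: "open S" "connected S"
    and e: "e > 0"
    and eq: "\<And>u. \<bar>u - s\<bar> < e \<Longrightarrow> complex_of_real u \<in> S \<and> f (of_real u) = g (of_real u)"
    and z: "z \<in> S"
  shows "f z = g z"
proof -
  let ?U = "complex_of_real ` {u. \<bar>u - s\<bar> < e}"
  have "f z - g z = 0"
  proof (rule analytic_continuation[of "\<lambda>z. f z - g z" S ?U "of_real s"])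
    show "complex_of_real s islimpt ?U"
      unfolding islimpt_approachable
    proof (intro allI impI)
      fix d :: real
      assume "d > 0"
      then show "\<exists>x'\<in>?U. x' \<noteq> complex_of_real s \<and> dist x' (complex_of_real s) < d"
        using e by (intro bexI[of _ "complex_of_real (s + min d e / 2)"])
          (auto simp: dist_norm norm_minus_commute simp flip: of_real_diff of_real_add)
    qed
    show "complex_of_real s \<in> S" using eq[of s] e by simp
  qed (use hol S eq z in \<open>auto intro!: holomorphic_intros\<close>)
  then show ?thesis by simp
qed

lemma power_series_coeffs_unique:
  fixes a b :: "nat \<Rightarrow> complex"
  assumes r: "r > 0"
    and a: "\<And>z. z \<in> ball w r \<Longrightarrow> (\<lambda>k. a k * (z - w) ^ k) sums f z"
    and b: "\<And>z. z \<in> ball w r \<Longrightarrow> (\<lambda>k. b k * (z - w) ^ k) sums f z"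
  shows "a = b"
proof
  fix m
  have diff: "(\<lambda>k. (a k - b k) * (z - w) ^ k) sums 0" if "norm (z - w) < r" for z
    using sums_diff[OF a[of z] b[of z]] that
    by (simp add: dist_norm norm_minus_commute left_diff_distrib)
  show "a m = b m"
  proof (cases "m = 0")
    case True
    have "a 0 - b 0 = 0"
      using diff[of w] r powser_sums_zero_iff[of "\<lambda>k. a k - b k" 0] by simp
    then show ?thesis using True by simp
  next
    case False
    show ?thesis
    proof (rule ccontr)
      assume "a m \<noteq> b m"
      then obtain s where s: "s > 0" "\<And>z. z \<in> cball w s - {w} \<Longrightarrow> (0::complex) \<noteq> 0"
        using powser_0_nonzero[OF r, of w "\<lambda>k. a k - b k" "\<lambda>_. 0" m] diff False by auto
      from s(1) have "w + of_real s \<in> cball w s - {w}"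
        by (simp add: dist_norm)
      with s(2) show False by blast
    qed
  qed
qed

lemma convex_strip: "convex {z. \<bar>Re z - s\<bar> < e}"
proof -
  have "{z. \<bar>Re z - s\<bar> < e} = {z. Re z < s + e} \<inter> {z. Re z > s - e}" by auto
  then show ?thesis
    by (simp add: convex_Int convex_halfspace_Re_lt convex_halfspace_Re_gt)
qed

lemma open_strip: "open {z. \<bar>Re z - s\<bar> < e}"
  by (intro open_Collect_less continuous_intros)

text \<open>Both transforms are holomorphic on the strip around the imaginary axis, so they agree on that axis,
  where they are the characteristic functions.\<close>

lemma real_distribution_eq_if_mgf_eq:
  assumes M: "real_distribution M" and N: "real_distribution N" and e: "e > 0"
    and int: "\<And>u. \<bar>u\<bar> < e \<Longrightarrow> integrable M (\<lambda>x. exp (u * x))"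
      "\<And>u. \<bar>u\<bar> < e \<Longrightarrow> integrable N (\<lambda>x. exp (u * x))"
    and eq: "\<And>u. \<bar>u\<bar> < e \<Longrightarrow> (\<integral>x. exp (u * x) \<partial>M) = (\<integral>x. exp (u * x) \<partial>N)"
  shows "M = N"
proof (rule Levy_uniqueness[OF M N], rule ext)
  fix t
  let ?L = "\<lambda>M z. \<integral>x. exp (z * complex_of_real x) \<partial>M"
  have "?L M (\<i> * of_real t) = ?L N (\<i> * of_real t)"
  proof (rule holomorphic_eq_if_eq_on_reals[where f = "?L M" and g = "?L N"
        and S = "{z. \<bar>Re z - 0\<bar> < e}" and s = 0 and e = e])
    show "?L M holomorphic_on {z. \<bar>Re z - 0\<bar> < e}"
      by (rule laplace_holomorphic[OF M e]) (use int in auto)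
    show "?L N holomorphic_on {z. \<bar>Re z - 0\<bar> < e}"
      by (rule laplace_holomorphic[OF N e]) (use int in auto)
    show "complex_of_real u \<in> {z. \<bar>Re z - 0\<bar> < e} \<and> ?L M (of_real u) = ?L N (of_real u)"
      if "\<bar>u - 0\<bar> < e" for u
      using that eq[of u] by (simp add: laplace_of_real)
  qed (use e convex_connected[OF convex_strip[of 0 e]] open_strip[of 0 e] in auto)
  then show "char M t = char N t"
    by (simp add: char_def mult.assoc)
qed

lemma integrable_power_exp:
  fixes M :: "real measure"
  assumes M: "real_distribution M" and h: "h > 0"
    and int: "integrable M (\<lambda>x. exp ((s + h) * x))" "integrable M (\<lambda>x. exp ((s - h) * x))"
  shows "integrable M (\<lambda>x. x ^ k * exp (s * x))"
proof -
  interpret real_distribution M by fact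
  have "\<bar>x ^ k * exp (s * x)\<bar> \<le> fact k / h ^ k * (exp ((s + h) * x) + exp ((s - h) * x))" for x
  proof -
    have "(\<bar>x\<bar> * h) ^ k /\<^sub>R fact k \<le> exp (\<bar>x\<bar> * h)"
    proof -
      have "(\<Sum>i\<in>{k}. (\<bar>x\<bar> * h) ^ i /\<^sub>R fact i) \<le> (\<Sum>i. (\<bar>x\<bar> * h) ^ i /\<^sub>R fact i)"
        using summable_exp_generic[of "\<bar>x\<bar> * h"] h by (intro sum_le_suminf) auto
      then show ?thesis by (simp add: exp_def)
    qed
    then have "exp (s * x) * ((\<bar>x\<bar> * h) ^ k /\<^sub>R fact k) \<le> exp ((s + h) * x) + exp ((s - h) * x)"
      using exp_le_exp_add_exp[of h h s x] h
      by (smt (verit, best) exp_gt_zero mult_left_mono)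
    then have "fact k / h ^ k * (exp (s * x) * ((\<bar>x\<bar> * h) ^ k /\<^sub>R fact k))
        \<le> fact k / h ^ k * (exp ((s + h) * x) + exp ((s - h) * x))"
      using h by (intro mult_left_mono) auto
    moreover have "fact k / h ^ k * (exp (s * x) * ((\<bar>x\<bar> * h) ^ k /\<^sub>R fact k)) = \<bar>x ^ k * exp (s * x)\<bar>"
      using h by (simp add: abs_mult power_abs power_mult_distrib divide_simps)
    ultimately show ?thesis by simp
  qed
  then show ?thesis
    using h by (intro Bochner_Integration.integrable_bound[OF integrable_mult_right[OF
        Bochner_Integration.integrable_add[OF int], of "fact k / h ^ k"]])
      (auto intro!: AE_I2 intro: order_trans[OF _ abs_ge_self])
qed

section \<open>Laplace transforms have real singularities\<close>

text \<open>This is the theorem of Landau and Pringsheim for two-sided Laplace transforms.  The Taylor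
  coefficients of \<open>G\<close> at \<open>s\<close> are the numbers \<open>C k\<close>, the moments of the measure with density
  \<open>exp (s * x)\<close> divided by \<open>k!\<close>, and their power series converges absolutely at every \<open>h < R\<close>.  Its even
  terms are integrals of nonnegative functions that add up to the integral of \<open>exp (s * x) * cosh (h * x)\<close>, which is
  therefore finite and controls \<open>exp ((s \<plusminus> h) * x)\<close>.  Using only the even coefficients avoids
  splitting the measure at zero.\<close>

lemma mgf_finite_on_disc_of_holomorphy:
  fixes M :: "real measure"
  assumes M: "real_distribution M" and e: "e > 0" and R: "R > 0"
    and G: "G holomorphic_on ball (complex_of_real s) R"
    and int: "\<And>u. \<bar>u - s\<bar> < e \<Longrightarrow> integrable M (\<lambda>x. exp (u * x))"
    and eq: "\<And>u. \<bar>u - s\<bar> < e \<Longrightarrow> G (of_real u) = of_real (\<integral>x. exp (u * x) \<partial>M)"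
    and u: "\<bar>u - s\<bar> < R"
  shows "integrable M (\<lambda>x. exp (u * x))" and "G (of_real u) = of_real (\<integral>x. exp (u * x) \<partial>M)"
proof -
  interpret real_distribution M by fact
  define e' where "e' = min e R"
  have e': "e' > 0" "e' \<le> e" "e' \<le> R" using e R by (auto simp: e'_def)
  let ?L = "\<lambda>z. \<integral>x. exp (z * complex_of_real x) \<partial>M"
  have sub: "ball (complex_of_real s) e' \<subseteq> {z. \<bar>Re z - s\<bar> < e}"
    using e'(2) abs_Re_le_cmod[of "z - of_real s" for z]
    by (force simp: dist_norm norm_minus_commute intro: le_less_trans)
  have LG: "G z = ?L z" if "z \<in> ball (complex_of_real s) e'" for z
  proof (rule holomorphic_eq_if_eq_on_reals[where f = G and g = ?L
        and S = "ball (complex_of_real s) e'" and s = s and e = e'])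
    show "?L holomorphic_on ball (complex_of_real s) e'"
      by (rule holomorphic_on_subset[OF laplace_holomorphic[OF M e int] sub])
    show "G holomorphic_on ball (complex_of_real s) e'"
      using e' by (intro holomorphic_on_subset[OF G]) auto
    show "complex_of_real u \<in> ball (complex_of_real s) e' \<and> G (of_real u) = ?L (of_real u)"
      if "\<bar>u - s\<bar> < e'" for u
      using that e' eq[of u]
      by (simp add: laplace_of_real dist_of_real dist_real_def abs_minus_commute)
  qed (use that e' in auto)
  define C where "C k = (\<integral>x. x ^ k * exp (s * x) \<partial>M) / fact k" for k
  have int_pow: "integrable M (\<lambda>x. x ^ k * exp (s * x))" for k
    using e' by (intro integrable_power_exp[OF M, of "e' / 2"] int) auto
  have coeffs: "(\<lambda>k. (deriv ^^ k) G (of_real s) / fact k) = (\<lambda>k. complex_of_real (C k))"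
  proof (rule power_series_coeffs_unique)
    show "e' / 2 > 0" using e' by simp
  next
    fix z assume z: "z \<in> ball (complex_of_real s) (e' / 2)"
    show "(\<lambda>k. (deriv ^^ k) G (of_real s) / fact k * (z - of_real s) ^ k) sums G z"
      by (rule holomorphic_power_series[OF G]) (use z e' in auto)
    have "(\<lambda>k. (\<integral>x. of_real x ^ k * exp (of_real s * of_real x) \<partial>M) / fact k * (z - of_real s) ^ k)
        sums ?L z"
      by (rule laplace_power_series[OF M, of s "e' / 2"])
        (use z e' in \<open>auto intro!: int simp: dist_norm norm_minus_commute\<close>)
    moreover have "?L z = G z" using z e' LG[of z] by auto
    moreover have "(\<integral>x. of_real x ^ k * exp (of_real s * of_real x) \<partial>M) / fact k = complex_of_real (C k)" for k
    proof -
      have "(\<integral>x. complex_of_real (x ^ k * exp (s * x)) \<partial>M)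
          = of_real (\<integral>x. x ^ k * exp (s * x) \<partial>M)"
        by (rule integral_complex_of_real)
      then show ?thesis by (simp add: C_def flip: exp_of_real)
    qed
    ultimately show "(\<lambda>k. complex_of_real (C k) * (z - of_real s) ^ k) sums G z" by simp
  qed
  have Cabs: "summable (\<lambda>k. \<bar>C k\<bar> * h ^ k)" if h: "0 \<le> h" "h < R" for h
  proof -
    obtain h' where h': "h < h'" "h' < R" using h dense by blast
    have "complex_of_real (s + h') \<in> ball (of_real s) R"
      using h h' by (simp add: dist_norm)
    from holomorphic_power_series[OF G this] 
    have "summable (\<lambda>k. complex_of_real (C k) * of_real h' ^ k)"
      by (simp add: fun_cong[OF coeffs] sums_iff)
    then have "summable (\<lambda>k. norm (complex_of_real (C k) * of_real h ^ k))"
      by (rule powser_insidea) (use h h' in simp)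
    then show ?thesis using h by (simp add: norm_mult norm_power)
  qed
  have int_both: "integrable M (\<lambda>x. exp ((s + h) * x) + exp ((s - h) * x))" if h: "0 < h" "h < R" for h
  proof -
    define f where "f k x = exp (s * x) * (if even k then (h * x) ^ k /\<^sub>R fact k else 0)" for k x
    have f_eq: "f k x = (if even k then h ^ k / fact k * (x ^ k * exp (s * x)) else 0)" for k x
      by (simp add: f_def power_mult_distrib divide_simps)
    have [measurable]: "f k \<in> borel_measurable M" for k
      unfolding f_eq[abs_def] by measurable
    have f_int: "integrable M (f k)" for k
      unfolding f_eq[abs_def] by (cases "even k") (simp_all add: int_pow del: times_divide_eq_left)
    have f_nn: "f k x \<ge> 0" for k x
      unfolding f_def by (simp add: zero_le_even_power)
    have int_f_le: "integral\<^sup>L M (f k) \<le> \<bar>C k\<bar> * h ^ k" for k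
    proof -
      have "integral\<^sup>L M (f k) = (if even k then C k * h ^ k else 0)"
        unfolding f_eq[abs_def] C_def by (cases "even k") (simp_all add: int_pow)
      also have "\<dots> \<le> \<bar>C k\<bar> * h ^ k"
        using h by (auto intro!: mult_right_mono)
      finally show ?thesis .
    qed
    have f_sums: "(\<lambda>k. f k x) sums (exp (s * x) * cosh (h * x))" for x
      unfolding f_def by (intro sums_mult cosh_converges)
    have "(\<integral>\<^sup>+x. ennreal (exp (s * x) * cosh (h * x)) \<partial>M) = (\<integral>\<^sup>+x. (\<Sum>k. ennreal (f k x)) \<partial>M)"
      using f_sums f_nn by (intro nn_integral_cong) (metis suminf_ennreal_eq)
    also have "\<dots> = (\<Sum>k. \<integral>\<^sup>+x. ennreal (f k x) \<partial>M)"
      by (rule nn_integral_suminf) simp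
    also have "\<dots> \<le> ennreal (\<Sum>k. \<bar>C k\<bar> * h ^ k)"
    proof (rule suminf_le_const)
      fix n
      have "(\<Sum>k<n. \<integral>\<^sup>+x. ennreal (f k x) \<partial>M) = (\<Sum>k<n. ennreal (integral\<^sup>L M (f k)))"
        by (intro sum.cong refl nn_integral_eq_integral f_int) (simp add: f_nn)
      also have "\<dots> = ennreal (\<Sum>k<n. integral\<^sup>L M (f k))"
        by (rule sum_ennreal) (simp add: f_nn integral_nonneg_AE)
      also have "\<dots> \<le> ennreal (\<Sum>k<n. \<bar>C k\<bar> * h ^ k)"
        by (intro ennreal_leI sum_mono int_f_le)
      also have "\<dots> \<le> ennreal (\<Sum>k. \<bar>C k\<bar> * h ^ k)"
        using h by (intro ennreal_leI sum_le_suminf Cabs) auto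
      finally show "(\<Sum>k<n. \<integral>\<^sup>+x. ennreal (f k x) \<partial>M) \<le> ennreal (\<Sum>k. \<bar>C k\<bar> * h ^ k)" .
    qed simp
    finally have "(\<integral>\<^sup>+x. ennreal (exp (s * x) * cosh (h * x)) \<partial>M) < \<infinity>"
      by (simp add: le_less_trans)
    then have "integrable M (\<lambda>x. exp (s * x) * cosh (h * x))"
      unfolding cosh_field_def by (intro integrableI_bounded) simp_all
    then have "integrable M (\<lambda>x. 2 * (exp (s * x) * cosh (h * x)))"
      by (rule integrable_mult_right)
    also have "(\<lambda>x. 2 * (exp (s * x) * cosh (h * x))) = (\<lambda>x. exp ((s + h) * x) + exp ((s - h) * x))"
      by (auto simp: cosh_field_def algebra_simps simp flip: exp_add)
    finally show ?thesis .
  qed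
  have int_R: "integrable M (\<lambda>x. exp (v * x))" if v: "\<bar>v - s\<bar> < R" for v
  proof (cases "v = s")
    case True
    then show ?thesis using int[of s] e by simp
  next
    case False
    show ?thesis
    proof (rule Bochner_Integration.integrable_bound[OF int_both[of "\<bar>v - s\<bar>"]])
      show "AE x in M. norm (exp (v * x)) \<le> norm (exp ((s + \<bar>v - s\<bar>) * x) + exp ((s - \<bar>v - s\<bar>) * x))"
        by (cases "v \<ge> s") auto
    qed (use v False in auto)
  qed
  show "integrable M (\<lambda>x. exp (u * x))" by (rule int_R[OF u])
  have "G (of_real u) = ?L (of_real u)"
  proof (rule holomorphic_eq_if_eq_on_reals[where f = G and g = ?L
        and S = "ball (complex_of_real s) R" and s = s and e = e'])
    have sub_R: "ball (complex_of_real s) R \<subseteq> {z. \<bar>Re z - s\<bar> < R}"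
      using abs_Re_le_cmod[of "z - of_real s" for z]
      by (force simp: dist_norm norm_minus_commute intro: le_less_trans)
    show "?L holomorphic_on ball (complex_of_real s) R"
      by (rule holomorphic_on_subset[OF laplace_holomorphic[OF M R int_R] sub_R])
    show "complex_of_real u \<in> ball (complex_of_real s) R \<and> G (of_real u) = ?L (of_real u)"
      if "\<bar>u - s\<bar> < e'" for u
      using that e' eq[of u]
      by (simp add: laplace_of_real dist_of_real dist_real_def abs_minus_commute)
    show "complex_of_real u \<in> ball (complex_of_real s) R"
      using u by (simp add: dist_of_real dist_real_def abs_minus_commute)
  qed (use G e' in auto)
  then show "G (of_real u) = of_real (\<integral>x. exp (u * x) \<partial>M)"
    by (simp add: laplace_of_real)
qed

text \<open>The points around which the transform is finite and equal to \<open>g\<close> form an open set.  It is also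
  closed in \<open>J\<close>: around any point of \<open>J\<close> there is a disc on which \<open>g\<close> is holomorphic, and the previous
  lemma carries the equality from any point near the centre to all other such points.\<close>

lemma mgf_eq_analytic_continuation:
  fixes M :: "real measure"
  assumes M: "real_distribution M" and J: "open J" "connected J" "s0 \<in> J" and e: "e > 0"
    and near: "\<And>u. \<bar>u - s0\<bar> < e \<Longrightarrow> integrable M (\<lambda>x. exp (u * x)) \<and> (\<integral>x. exp (u * x) \<partial>M) = g u"
    and g: "\<And>u. u \<in> J \<Longrightarrow> real_analytic_at g u"
    and u: "u \<in> J"
  shows "integrable M (\<lambda>x. exp (u * x)) \<and> (\<integral>x. exp (u * x) \<partial>M) = g u"
proof -
  define Q where "Q u \<longleftrightarrow> integrable M (\<lambda>x. exp (u * x)) \<and> (\<integral>x. exp (u * x) \<partial>M) = g u" for u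
  define P where "P s \<longleftrightarrow> (\<exists>d>0. \<forall>u. \<bar>u - s\<bar> < d \<longrightarrow> Q u)" for s
  have "P u"
  proof (rule connected_induction_simple[OF J(2,3) u])
    show "P s0" unfolding P_def Q_def using e near by blast
  next
    fix a assume a: "a \<in> J"
    obtain F r where r: "r > 0" and hol: "F holomorphic_on ball (complex_of_real a) r"
      and F: "\<And>y. \<bar>y - a\<bar> < r \<Longrightarrow> F (of_real y) = of_real (g y)"
      using real_analytic_at_holomorphic_extension[OF g[OF a]] by blast
    have "P y" if x: "\<bar>x - a\<bar> < r / 4" and y: "\<bar>y - a\<bar> < r / 4" and P: "P x" for x y
    proof -
      obtain d where d: "d > 0" "\<And>u. \<bar>u - x\<bar> < d \<Longrightarrow> Q u" using P unfolding P_def by blast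
      define d' where "d' = min d (r / 2)"
      have sub: "ball (complex_of_real x) (r / 2) \<subseteq> ball (complex_of_real a) r"
        using x r by (intro ball_subset_ball_iff[THEN iffD2] disjI1)
          (simp add: dist_of_real dist_real_def)
      have *: "integrable M (\<lambda>x. exp (u * x)) \<and> F (of_real u) = of_real (\<integral>x. exp (u * x) \<partial>M)"
        if "\<bar>u - x\<bar> < r / 2" for u
      proof (intro conjI)
        have d': "d' > 0" using d(1) r by (simp add: d'_def)
        have 1: "integrable M (\<lambda>x. exp (u * x))" "F (of_real u) = of_real (\<integral>x. exp (u * x) \<partial>M)"
          if "\<bar>u - x\<bar> < d'" for u
        proof -
          have "\<bar>u - a\<bar> \<le> \<bar>u - x\<bar> + \<bar>x - a\<bar>" by linarith
          then have "\<bar>u - a\<bar> < r" "\<bar>u - x\<bar> < d"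
            using that x abs_ge_zero[of "x - a"] unfolding d'_def by linarith+
          then show "integrable M (\<lambda>x. exp (u * x))" "F (of_real u) = of_real (\<integral>x. exp (u * x) \<partial>M)"
            using d(2)[of u] F[of u] by (simp_all add: Q_def)
        qed
        show "integrable M (\<lambda>x. exp (u * x))"
          by (rule mgf_finite_on_disc_of_holomorphy(1)[OF M d' _ holomorphic_on_subset[OF hol sub] 1 that])
            (use r in auto)
        show "F (of_real u) = of_real (\<integral>x. exp (u * x) \<partial>M)"
          by (rule mgf_finite_on_disc_of_holomorphy(2)[OF M d' _ holomorphic_on_subset[OF hol sub] 1 that])
            (use r in auto)
      qed
      have "Q u" if "\<bar>u - y\<bar> < r / 2 - \<bar>y - x\<bar>" for u
      proof -
        have "\<bar>u - x\<bar> \<le> \<bar>u - y\<bar> + \<bar>y - x\<bar>" "\<bar>u - a\<bar> \<le> \<bar>u - x\<bar> + \<bar>x - a\<bar>"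
          by linarith+
        then have "\<bar>u - x\<bar> < r / 2" "\<bar>u - a\<bar> < r"
          using that x abs_ge_zero[of "x - a"] by linarith+
        then show ?thesis using *[of u] F[of u] by (simp add: Q_def)
      qed
      moreover have "\<bar>y - x\<bar> \<le> \<bar>x - a\<bar> + \<bar>y - a\<bar>" by linarith
      then have "r / 2 - \<bar>y - x\<bar> > 0" using x y by linarith
      ultimately show "P y" unfolding P_def by blast
    qed
    then show "\<exists>T. openin (top_of_set J) T \<and> a \<in> T \<and> (\<forall>x\<in>T. \<forall>y\<in>T. P x \<longrightarrow> P y)"
      using a r by (intro exI[of _ "J \<inter> ball a (r / 4)"])
        (auto simp: dist_real_def abs_minus_commute openin_open_Int)
  qed
  then show ?thesis by (auto simp: P_def Q_def)
qed

section \<open>The continuity theorem for Laplace transforms\<close>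

text \<open>The functions \<open>exp (u * clip R x)\<close> are bounded and continuous, so weak convergence applies to them,
  and they differ from \<open>exp (u * x)\<close> only where \<open>\<bar>x\<bar> > R\<close>.\<close>

definition clip :: "nat \<Rightarrow> real \<Rightarrow> real" where
  "clip R x = max (- real R) (min (real R) x)"

lemma exp_clip_le: "exp (u * clip R x) \<le> exp (u * x) + 1" for u :: real
proof -
  have "u * clip R x \<le> max (u * x) 0"
  proof (cases "u \<ge> 0")
    case True
    have "clip R x \<le> max x 0" by (auto simp: clip_def)
    then have "u * clip R x \<le> u * max x 0" using True by (rule mult_left_mono)
    then show ?thesis by (auto simp: max_def split: if_splits)
  next
    case False
    have "clip R x \<ge> min x 0" by (auto simp: clip_def)
    then have "u * clip R x \<le> u * min x 0" using False by (intro mult_left_mono_neg) auto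
    then show ?thesis by (auto simp: min_def max_def split: if_splits)
  qed
  then have "exp (u * clip R x) \<le> exp (max (u * x) 0)" by simp
  also have "\<dots> \<le> exp (u * x) + 1" by (auto simp: max_def)
  finally show ?thesis .
qed

lemma isCont_exp_clip: "isCont (\<lambda>x. exp (u * clip R x)) x"
  unfolding clip_def by (intro continuous_intros)

lemma exp_clip_bound: "norm (exp (u * clip R x)) \<le> exp (\<bar>u\<bar> * R)"
proof -
  have "\<bar>clip R x\<bar> \<le> R" by (auto simp: clip_def)
  then have "\<bar>u * clip R x\<bar> \<le> \<bar>u\<bar> * R" by (simp add: abs_mult mult_left_mono)
  then show ?thesis by simp
qed

lemma exp_clip_error:
  assumes "\<bar>u\<bar> < u'"
  shows "\<bar>exp (u * x) - exp (u * clip R x)\<bar> \<le> exp (- (u' - \<bar>u\<bar>) * R) * (exp (u' * x) + exp (- u' * x))"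
proof (cases "\<bar>x\<bar> \<le> R")
  case True
  then have "clip R x = x" by (auto simp: clip_def)
  then show ?thesis by simp
next
  case False
  have le: "exp (u * y) \<le> exp (\<bar>u\<bar> * \<bar>x\<bar>)" if "\<bar>y\<bar> \<le> \<bar>x\<bar>" for y
  proof -
    have "u * y \<le> \<bar>u\<bar> * \<bar>y\<bar>" by (metis abs_ge_self abs_mult)
    also have "\<dots> \<le> \<bar>u\<bar> * \<bar>x\<bar>" using that by (intro mult_left_mono) auto
    finally show ?thesis by simp
  qed
  have "\<bar>clip R x\<bar> \<le> \<bar>x\<bar>" using False by (auto simp: clip_def)
  then have "\<bar>exp (u * x) - exp (u * clip R x)\<bar> \<le> exp (\<bar>u\<bar> * \<bar>x\<bar>)"
    using le[of x] le[of "clip R x"] by (smt (verit) exp_gt_zero)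
  also have "\<dots> = exp (- (u' - \<bar>u\<bar>) * \<bar>x\<bar>) * exp (u' * \<bar>x\<bar>)"
    by (simp add: algebra_simps flip: exp_add)
  also have "\<dots> \<le> exp (- (u' - \<bar>u\<bar>) * R) * (exp (u' * x) + exp (- u' * x))"
  proof (rule mult_mono)
    show "exp (- (u' - \<bar>u\<bar>) * \<bar>x\<bar>) \<le> exp (- (u' - \<bar>u\<bar>) * R)"
      using False assms by (simp add: mult_left_mono)
    show "exp (u' * \<bar>x\<bar>) \<le> exp (u' * x) + exp (- u' * x)"
      by (cases "x \<ge> 0") (auto simp: add_increasing add_increasing2)
  qed auto
  finally show ?thesis .
qed

text \<open>Fatou's lemma gives integrability in the limit.  For the value, choose \<open>u'\<close> between \<open>\<bar>u\<bar>\<close> and \<open>\<eta>\<close>: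
  clipping at \<open>R\<close> changes each integral by at most \<open>exp (- (u' - \<bar>u\<bar>) * R)\<close> times a bound that is
  uniform in \<open>n\<close>, namely one on the transforms at \<open>\<plusminus>u'\<close>.\<close>

lemma mgf_weak_limit:
  fixes M :: "nat \<Rightarrow> real measure"
  assumes M: "\<And>n. real_distribution (M n)" and N: "real_distribution N" and conv: "weak_conv_m M N"
    and int: "\<And>n u. \<bar>u\<bar> < \<eta> \<Longrightarrow> integrable (M n) (\<lambda>x. exp (u * x))"
    and lim: "\<And>u. \<bar>u\<bar> < \<eta> \<Longrightarrow> (\<lambda>n. \<integral>x. exp (u * x) \<partial>M n) \<longlonglongrightarrow> m u"
    and u: "\<bar>u\<bar> < \<eta>"
  shows "integrable N (\<lambda>x. exp (u * x))" and "(\<integral>x. exp (u * x) \<partial>N) = m u"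
proof -
  interpret N: real_distribution N by fact
  have meas: "(\<lambda>x. exp (u * clip R x)) \<in> borel_measurable K" if "real_distribution K" for u R and K :: "real measure"
  proof -
    interpret K: real_distribution K by fact
    show ?thesis unfolding clip_def by measurable
  qed
  have int_clip: "integrable K (\<lambda>x. exp (u * clip R x))" if "real_distribution K" for u R and K :: "real measure"
  proof -
    interpret K: real_distribution K by fact
    show ?thesis
      by (rule K.integrable_const_bound[where B = "exp (\<bar>u\<bar> * R)"])
        (use exp_clip_bound meas[OF that] in auto)
  qed
  have clip_lim: "(\<lambda>n. \<integral>x. exp (u * clip R x) \<partial>M n) \<longlonglongrightarrow> (\<integral>x. exp (u * clip R x) \<partial>N)" for u R
    by (rule weak_conv_imp_integral_bdd_continuous_conv[OF M N conv isCont_exp_clip exp_clip_bound])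
  have int_N: "integrable N (\<lambda>x. exp (u * x))" if u: "\<bar>u\<bar> < \<eta>" for u
  proof (rule integrableI_bounded)
    have "(\<integral>\<^sup>+x. ennreal (norm (exp (u * x))) \<partial>N) = (\<integral>\<^sup>+x. liminf (\<lambda>R. ennreal (exp (u * clip R x))) \<partial>N)"
    proof (rule nn_integral_cong)
      fix x
      obtain R0 where R0: "\<bar>x\<bar> \<le> real R0" using real_arch_simple by blast
      have "\<forall>\<^sub>F R in sequentially. ennreal (exp (u * clip R x)) = ennreal (exp (u * x))"
        using eventually_ge_at_top[of R0] by eventually_elim (use R0 in \<open>auto simp: clip_def\<close>)
      then have "(\<lambda>R. ennreal (exp (u * clip R x))) \<longlonglongrightarrow> ennreal (exp (u * x))"
        by (rule tendsto_eventually)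
      then show "ennreal (norm (exp (u * x))) = liminf (\<lambda>R. ennreal (exp (u * clip R x)))"
        by (subst lim_imp_Liminf[OF sequentially_bot]) simp_all
    qed
    also have "\<dots> \<le> liminf (\<lambda>R. \<integral>\<^sup>+x. ennreal (exp (u * clip R x)) \<partial>N)"
      by (rule nn_integral_liminf) (use meas[OF N] in measurable)
    also have "\<dots> \<le> liminf (\<lambda>R. ennreal (m u + 1))"
    proof (intro Liminf_mono always_eventually allI)
      fix R
      have "(\<integral>x. exp (u * clip R x) \<partial>N) \<le> m u + 1"
      proof (rule tendsto_le[OF _ tendsto_add[OF lim[OF u] tendsto_const] clip_lim])
        show "\<forall>\<^sub>F n in sequentially. (\<integral>x. exp (u * clip R x) \<partial>M n) \<le> (\<integral>x. exp (u * x) \<partial>M n) + 1"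
        proof (intro always_eventually allI)
          fix n
          interpret Mn: real_distribution "M n" by (rule M)
          have "(\<integral>x. exp (u * clip R x) \<partial>M n) \<le> (\<integral>x. exp (u * x) + 1 \<partial>M n)"
            by (intro integral_mono int_clip M Bochner_Integration.integrable_add int u exp_clip_le) simp
          also have "\<dots> = (\<integral>x. exp (u * x) \<partial>M n) + 1"
            using int[OF u, of n] by (simp add: Mn.prob_space[simplified])
          finally show "(\<integral>x. exp (u * clip R x) \<partial>M n) \<le> (\<integral>x. exp (u * x) \<partial>M n) + 1" .
        qed
      qed simp
      then show "(\<integral>\<^sup>+x. ennreal (exp (u * clip R x)) \<partial>N) \<le> ennreal (m u + 1)"
        by (subst nn_integral_eq_integral[OF int_clip[OF N]]) (auto intro: ennreal_leI)
    qed
    also have "\<dots> < \<infinity>" by (simp add: Liminf_const)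
    finally show "(\<integral>\<^sup>+x. ennreal (norm (exp (u * x))) \<partial>N) < \<infinity>" .
  qed simp
  show "integrable N (\<lambda>x. exp (u * x))" by (rule int_N[OF u])
  obtain u' where u': "\<bar>u\<bar> < u'" "u' < \<eta>" using u dense by blast
  then have u'_abs: "\<bar>u'\<bar> < \<eta>" "\<bar>- u'\<bar> < \<eta>" by auto
  define S where "S K = (\<integral>x. exp (u' * x) \<partial>K) + (\<integral>x. exp (- u' * x) \<partial>K)" for K :: "real measure"
  have error: "\<bar>(\<integral>x. exp (u * x) \<partial>K) - (\<integral>x. exp (u * clip R x) \<partial>K)\<bar> \<le> exp (- (u' - \<bar>u\<bar>) * R) * S K"
    if K: "real_distribution K" and int: "\<And>u. \<bar>u\<bar> < \<eta> \<Longrightarrow> integrable K (\<lambda>x. exp (u * x))" for K R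
  proof -
    have 1: "integrable K (\<lambda>x. exp (u * x) - exp (u * clip R x))"
      by (intro Bochner_Integration.integrable_diff int u int_clip K)
    have "\<bar>(\<integral>x. exp (u * x) \<partial>K) - (\<integral>x. exp (u * clip R x) \<partial>K)\<bar> = \<bar>\<integral>x. exp (u * x) - exp (u * clip R x) \<partial>K\<bar>"
      by (subst Bochner_Integration.integral_diff) (auto intro: int u int_clip K)
    also have "\<dots> \<le> (\<integral>x. \<bar>exp (u * x) - exp (u * clip R x)\<bar> \<partial>K)"
      by (rule integral_abs_bound)
    also have "\<dots> \<le> (\<integral>x. exp (- (u' - \<bar>u\<bar>) * R) * (exp (u' * x) + exp (- u' * x)) \<partial>K)"
      by (intro integral_mono integrable_abs 1 integrable_mult_right Bochner_Integration.integrable_add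
          int u'_abs exp_clip_error u')
    also have "\<dots> = exp (- (u' - \<bar>u\<bar>) * R) * S K"
      unfolding S_def by (subst integral_mult_right_zero, subst Bochner_Integration.integral_add)
        (use int[OF u'_abs(1)] int[OF u'_abs(2)] in auto)
    finally show ?thesis .
  qed
  have lim_error: "\<bar>m u - (\<integral>x. exp (u * clip R x) \<partial>N)\<bar> \<le> exp (- (u' - \<bar>u\<bar>) * R) * (m u' + m (- u'))" for R
  proof (rule tendsto_le[OF sequentially_bot])
    show "(\<lambda>n. \<bar>(\<integral>x. exp (u * x) \<partial>M n) - (\<integral>x. exp (u * clip R x) \<partial>M n)\<bar>)
        \<longlonglongrightarrow> \<bar>m u - (\<integral>x. exp (u * clip R x) \<partial>N)\<bar>"
      by (intro tendsto_intros lim u clip_lim)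
    show "(\<lambda>n. exp (- (u' - \<bar>u\<bar>) * R) * S (M n)) \<longlonglongrightarrow> exp (- (u' - \<bar>u\<bar>) * R) * (m u' + m (- u'))"
      unfolding S_def by (intro tendsto_intros lim u'_abs)
    show "\<forall>\<^sub>F n in sequentially. \<bar>(\<integral>x. exp (u * x) \<partial>M n) - (\<integral>x. exp (u * clip R x) \<partial>M n)\<bar>
        \<le> exp (- (u' - \<bar>u\<bar>) * R) * S (M n)"
      by (intro always_eventually allI error M int)
  qed
  define B where "B = m u' + m (- u') + S N"
  have "\<bar>m u - (\<integral>x. exp (u * x) \<partial>N)\<bar> \<le> exp (- (u' - \<bar>u\<bar>) * real R) * B" for R :: nat
    using error[OF N int_N, of R] lim_error[of R] by (simp add: B_def algebra_simps)
  moreover have "(\<lambda>R::nat. exp (- (u' - \<bar>u\<bar>) * real R) * B) \<longlonglongrightarrow> 0"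
  proof -
    have "filterlim (\<lambda>R::nat. - (u' - \<bar>u\<bar>) * real R) at_bot sequentially"
      using u' by (intro filterlim_tendsto_neg_mult_at_bot[OF tendsto_const] filterlim_real_sequentially) auto
    then have "(\<lambda>R::nat. exp (- (u' - \<bar>u\<bar>) * real R)) \<longlonglongrightarrow> 0"
      by (rule filterlim_compose[OF exp_at_bot])
    then show ?thesis by (rule tendsto_mult_left_zero)
  qed
  ultimately have "\<bar>m u - (\<integral>x. exp (u * x) \<partial>N)\<bar> \<le> 0"
    by (intro tendsto_le[OF sequentially_bot _ tendsto_const[of "\<bar>m u - (\<integral>x. exp (u * x) \<partial>N)\<bar>"]]) auto
  then show "(\<integral>x. exp (u * x) \<partial>N) = m u" by simp
qed

lemma tight_if_mgf_bounded:
  fixes M :: "nat \<Rightarrow> real measure"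
  assumes M: "\<And>n. real_distribution (M n)" and u: "u > 0"
    and int: "\<And>n. integrable (M n) (\<lambda>x. exp (u * x))" "\<And>n. integrable (M n) (\<lambda>x. exp (- u * x))"
    and B: "\<And>n. (\<integral>x. exp (u * x) \<partial>M n) + (\<integral>x. exp (- u * x) \<partial>M n) \<le> B"
  shows "tight M"
  unfolding tight_def
proof (intro conjI allI impI M)
  fix \<epsilon> :: real assume \<epsilon>: "\<epsilon> > 0"
  have "((\<lambda>R. B / exp (u * R)) \<longlongrightarrow> 0) at_top"
    using u by (intro real_tendsto_divide_at_top[OF tendsto_const] filterlim_compose[OF exp_at_top]
        filterlim_tendsto_pos_mult_at_top[OF tendsto_const] filterlim_ident)
  then have "\<forall>\<^sub>F R in at_top. B / exp (u * R) < \<epsilon>"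
    using \<epsilon> by (rule order_tendstoD)
  then have "\<forall>\<^sub>F R in at_top. B / exp (u * R) < \<epsilon> \<and> R > 0"
    by (intro eventually_conj eventually_gt_at_top)
  then obtain R where R: "B / exp (u * R) < \<epsilon>" "R > 0"
    by (metis (no_types, lifting) eventually_happens' trivial_limit_at_top_linorder)
  have "measure (M n) {-R<..R} > 1 - \<epsilon>" for n
  proof -
    interpret real_distribution "M n" by (rule M)
    let ?f = "\<lambda>x. exp (u * x) + exp (- u * x)"
    have "prob (UNIV - {-R<..R}) \<le> prob {x \<in> space (M n). ?f x \<ge> exp (u * R)}"
    proof (rule finite_measure_mono)
      show "UNIV - {-R<..R} \<subseteq> {x \<in> space (M n). ?f x \<ge> exp (u * R)}"
      proof safe
        fix x assume "x \<notin> {-R<..R}"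
        then have "x \<le> - R \<or> x \<ge> R" by auto
        then have "exp (u * R) \<le> exp (u * x) \<or> exp (u * R) \<le> exp (- u * x)"
        proof
          assume "x \<le> - R"
          then have "u * R \<le> u * (- x)" using u by (intro mult_left_mono) auto
          then show ?thesis by simp
        next
          assume "x \<ge> R"
          then show ?thesis using u by simp
        qed
        then show "exp (u * R) \<le> ?f x" by (smt (verit) exp_gt_zero)
      qed simp
    qed simp
    also have "\<dots> \<le> (\<integral>x. ?f x \<partial>M n) / exp (u * R)"
      by (rule integral_Markov_inequality_measure[where A = "{}"])
        (use int[of n] in \<open>auto intro!: AE_I2 add_nonneg_nonneg\<close>)
    also have "(\<integral>x. ?f x \<partial>M n) \<le> B"
      using B[of n] int[of n] by simp
    then have "(\<integral>x. ?f x \<partial>M n) / exp (u * R) \<le> B / exp (u * R)"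
      by (intro divide_right_mono) auto
    also note R(1)
    finally show ?thesis using prob_compl[of "{-R<..R}"] by simp
  qed
  then show "\<exists>a b. a < b \<and> (\<forall>n. measure (M n) {a<..b} > 1 - \<epsilon>)"
    using R(2) by (intro exI[of _ "-R"] exI[of _ R]) auto
qed

text \<open>Convergence at \<open>\<plusminus>\<eta>/2\<close> gives tightness.  By the previous lemmas all weak limits of subsequences
  have the transform \<open>m\<close>, hence they coincide.\<close>

lemma mgf_continuity:
  fixes M :: "nat \<Rightarrow> real measure"
  assumes M: "\<And>n. real_distribution (M n)" and \<eta>: "\<eta> > 0"
    and int: "\<And>n u. \<bar>u\<bar> < \<eta> \<Longrightarrow> integrable (M n) (\<lambda>x. exp (u * x))"
    and lim: "\<And>u. \<bar>u\<bar> < \<eta> \<Longrightarrow> (\<lambda>n. \<integral>x. exp (u * x) \<partial>M n) \<longlonglongrightarrow> m u"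
  obtains N where "real_distribution N" "weak_conv_m M N"
    "\<And>u. \<bar>u\<bar> < \<eta> \<Longrightarrow> integrable N (\<lambda>x. exp (u * x)) \<and> (\<integral>x. exp (u * x) \<partial>N) = m u"
proof -
  define u where "u = \<eta> / 2"
  have u: "u > 0" "\<bar>u\<bar> < \<eta>" "\<bar>- u\<bar> < \<eta>" using \<eta> by (auto simp: u_def)
  have "convergent (\<lambda>n. (\<integral>x. exp (u * x) \<partial>M n) + (\<integral>x. exp (- u * x) \<partial>M n))"
    using tendsto_add[OF lim[OF u(2)] lim[OF u(3)]] by (auto simp: convergent_def)
  then have "Bseq (\<lambda>n. (\<integral>x. exp (u * x) \<partial>M n) + (\<integral>x. exp (- u * x) \<partial>M n))"
    by (rule convergent_imp_Bseq)
  then obtain B where B: "\<And>n. norm ((\<integral>x. exp (u * x) \<partial>M n) + (\<integral>x. exp (- u * x) \<partial>M n)) \<le> B"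
    unfolding Bseq_def by blast
  have tight: "tight M"
  proof (rule tight_if_mgf_bounded[OF M u(1) int[OF u(2)] int[OF u(3)]])
    show "(\<integral>x. exp (u * x) \<partial>M n) + (\<integral>x. exp (- u * x) \<partial>M n) \<le> B" for n
      using B[of n] by simp
  qed
  have sub: "integrable \<nu> (\<lambda>x. exp (v * x)) \<and> (\<integral>x. exp (v * x) \<partial>\<nu>) = m v"
    if "strict_mono s" "real_distribution \<nu>" "weak_conv_m (M \<circ> s) \<nu>" "\<bar>v\<bar> < \<eta>" for s \<nu> v
  proof -
    have "(\<lambda>n. \<integral>x. exp (v * x) \<partial>(M \<circ> s) n) \<longlonglongrightarrow> m v" if "\<bar>v\<bar> < \<eta>" for v
      using LIMSEQ_subseq_LIMSEQ[OF lim[OF that] \<open>strict_mono s\<close>] by (simp add: o_def)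
    then show ?thesis
      using mgf_weak_limit[of "M \<circ> s" \<nu> \<eta> m v] that M int by auto
  qed
  obtain r N where r: "strict_mono r" and N: "real_distribution N" and "weak_conv_m (M \<circ> id \<circ> r) N"
    using tight_imp_convergent_subsubsequence[OF tight, of id] by (auto simp: strict_mono_id)
  then have mgf_N: "integrable N (\<lambda>x. exp (v * x)) \<and> (\<integral>x. exp (v * x) \<partial>N) = m v" if "\<bar>v\<bar> < \<eta>" for v
    using sub[of r N v] that by simp
  have "weak_conv_m M N"
  proof (rule tight_subseq_weak_converge[OF M N tight])
    fix s :: "nat \<Rightarrow> nat" and \<nu>
    assume s: "strict_mono s" and \<nu>: "real_distribution \<nu>" and conv: "weak_conv_m (M \<circ> s) \<nu>"
    have "\<nu> = N"
      by (rule real_distribution_eq_if_mgf_eq[OF \<nu> N \<eta>]) (use sub[OF s \<nu> conv] mgf_N in auto)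
    then show "weak_conv_m (M \<circ> s) N" using conv by simp
  qed
  then show ?thesis using N mgf_N that by blast
qed

section \<open>Factorial cumulant generating functions\<close>

lemma mgf_pos:
  assumes "real_distribution M" and "integrable M (\<lambda>x. exp (u * x))"
  shows "0 < (\<integral>x. exp (u * x) \<partial>M)"
proof -
  interpret real_distribution M by fact
  show ?thesis using assms(2) by (intro expectation_greater) auto
qed

lemma powr_eq_exp_ln: "t > -1 \<Longrightarrow> (powr) (1 + t) = (\<lambda>x. exp (ln (1 + t) * x))" for t :: real
  by (auto simp: powr_def mult.commute)

lemma mem_fcgf_dom_iff: "t \<in> fcgf_dom M \<longleftrightarrow> t > -1 \<and> integrable M (\<lambda>x. exp (ln (1 + t) * x))"
  unfolding fcgf_dom_def by (auto simp: powr_eq_exp_ln)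

lemma exp_fcgf:
  assumes "real_distribution M" "t \<in> fcgf_dom M"
  shows "exp (fcgf M t) = (\<integral>x. exp (ln (1 + t) * x) \<partial>M)"
  using assms mgf_pos[of M "ln (1 + t)"] by (auto simp: fcgf_def mem_fcgf_dom_iff powr_eq_exp_ln)

text \<open>The continuation of the Laplace transform in the variable \<open>s = ln (1 + t)\<close>, applied to
  \<open>s \<mapsto> exp (K (exp s - 1))\<close>.  The bound \<open>d \<le> 1\<close> keeps \<open>t\<close> above \<open>-1\<close>.\<close>

lemma fcgf_eq_analytic_continuation:
  assumes M: "real_distribution M" and d: "0 < d" "d \<le> 1" and e: "e > 0"
    and near: "\<And>t. \<bar>t\<bar> < e \<Longrightarrow> t \<in> fcgf_dom M \<and> K t = fcgf M t"
    and K: "\<And>t. \<bar>t\<bar> < d \<Longrightarrow> real_analytic_at K t"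
    and t: "\<bar>t\<bar> < d"
  shows "t \<in> fcgf_dom M \<and> exp (K t) = (\<integral>x. exp (ln (1 + t) * x) \<partial>M)"
proof -
  define J where "J = {s::real. \<bar>exp s - 1\<bar> < d}"
  have J_open: "open J" unfolding J_def by (intro open_Collect_less continuous_intros)
  have "is_interval J"
    unfolding is_interval_1 J_def
  proof safe
    fix a b x :: real
    assume "\<bar>exp a - 1\<bar> < d" "\<bar>exp b - 1\<bar> < d" "a \<le> x" "x \<le> b"
    moreover have "exp a \<le> exp x" "exp x \<le> exp b" using \<open>a \<le> x\<close> \<open>x \<le> b\<close> by auto
    ultimately show "\<bar>exp x - 1\<bar> < d" by linarith
  qed
  then have J_conn: "connected J" by (rule is_interval_connected)
  have "isCont (\<lambda>s::real. exp s - 1) 0" by (intro continuous_intros)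
  then obtain e' where e': "e' > 0" "\<And>s::real. \<bar>s\<bar> < e' \<Longrightarrow> \<bar>exp s - 1\<bar> < e"
    using e unfolding continuous_at_eps_delta by (auto simp: dist_real_def)
  have "integrable M (\<lambda>x. exp (ln (1 + t) * x)) \<and>
      (\<integral>x. exp (ln (1 + t) * x) \<partial>M) = exp (K (exp (ln (1 + t)) - 1))"
  proof (rule mgf_eq_analytic_continuation[OF M J_open J_conn _ e'(1), of 0])
    show "0 \<in> J" using d by (simp add: J_def)
    show "ln (1 + t) \<in> J" using t d by (simp add: J_def)
    fix s :: real
    show "integrable M (\<lambda>x. exp (s * x)) \<and> (\<integral>x. exp (s * x) \<partial>M) = exp (K (exp s - 1))"
      if "\<bar>s - 0\<bar> < e'"
      using near[of "exp s - 1"] e'(2)[of s] that exp_fcgf[OF M, of "exp s - 1"]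
      by (auto simp: mem_fcgf_dom_iff)
    assume s: "s \<in> J"
    obtain F r where r: "r > 0" and hol: "F holomorphic_on ball (complex_of_real (exp s - 1)) r"
      and F: "\<And>y. \<bar>y - (exp s - 1)\<bar> < r \<Longrightarrow> F (of_real y) = of_real (K y)"
      using real_analytic_at_holomorphic_extension[OF K, of "exp s - 1"] s
      unfolding J_def mem_Collect_eq by blast
    define U where "U = {z. dist (complex_of_real (exp s - 1)) (exp z - 1) < r}"
    have "open U" unfolding U_def by (intro open_Collect_less continuous_intros)
    moreover have "complex_of_real s \<in> U" using r by (simp add: U_def exp_of_real)
    ultimately obtain \<rho> where \<rho>: "\<rho> > 0" "ball (complex_of_real s) \<rho> \<subseteq> U"
      by (meson open_contains_ball)
    show "real_analytic_at (\<lambda>s. exp (K (exp s - 1))) s"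
    proof (rule real_analytic_at_if_Re_holomorphic[OF _ \<rho>(1)])
      have "(F \<circ> (\<lambda>z. exp z - 1)) holomorphic_on U"
        by (intro holomorphic_on_compose_gen[OF _ hol] holomorphic_intros) (auto simp: U_def)
      then show "(\<lambda>z. exp (F (exp z - 1))) holomorphic_on ball (complex_of_real s) \<rho>"
        using \<rho>(2) by (intro holomorphic_intros) (auto simp: o_def intro: holomorphic_on_subset)
      fix y :: real assume "\<bar>y - s\<bar> < \<rho>"
      then have "complex_of_real y \<in> U"
        using \<rho>(2) by (auto simp: dist_of_real dist_real_def abs_minus_commute)
      moreover have "exp (complex_of_real y) - 1 = of_real (exp y - 1)" by (simp add: exp_of_real)
      ultimately have "dist (complex_of_real (exp s - 1)) (of_real (exp y - 1)) < r"
        unfolding U_def by simp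
      then have "\<bar>(exp y - 1) - (exp s - 1)\<bar> < r"
        unfolding dist_of_real dist_real_def by linarith
      from F[OF this] show "exp (K (exp y - 1)) = Re (exp (F (exp (complex_of_real y) - 1)))"
        by (simp add: exp_of_real)
    qed
  qed
  moreover have "t > -1" using t d by linarith
  ultimately show ?thesis by (simp add: mem_fcgf_dom_iff)
qed

text \<open>An FCGF agrees with its law only within its analytic domain, which may have zero as an endpoint.
  For an interior parameter \<open>\<theta>\<close> the analytic domain of the tilting surrounds zero, and the agreement
  is two-sided.\<close>

lemma tilt_eq_fcgf_near_zero:
  assumes C: "C \<in> fcgfs" and \<theta>: "\<theta> \<in> interior (analytic_dom C)" and M: "has_fcgf M (tilt C \<theta>)"
  obtains e where "e > 0" "\<And>t. \<bar>t\<bar> < e \<Longrightarrow> t \<in> fcgf_dom M \<and> tilt C \<theta> t = fcgf M t"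
proof -
  let ?D = "interior (analytic_dom C)"
  have AI: "analytic_interval C (analytic_dom C)"
    using C by (simp add: fcgfs_def analytic_funs_def)
  obtain d where d: "d > 0" "ball \<theta> d \<subseteq> ?D"
    using \<theta> open_contains_ball open_interior by blast
  have "analytic_interval (tilt C \<theta>) (ball (0::real) d)"
  proof (rule analytic_interval_open)
    fix x assume "x \<in> ball (0::real) d"
    then have "\<theta> + x \<in> ?D" using d(2) by (auto simp: dist_real_def)
    then show "real_analytic_at (tilt C \<theta>) x"
      using AI by (intro real_analytic_at_tilt) (simp add: analytic_interval_def)
  qed (use d(1) in \<open>auto simp: is_interval_ball_real\<close>)
  then have sub: "ball (0::real) d \<subseteq> analytic_dom (tilt C \<theta>)" by (rule analytic_interval_subset_dom)
  have "\<forall>\<^sub>F t in at 0 within analytic_dom (tilt C \<theta>). t \<in> fcgf_dom M \<and> tilt C \<theta> t = fcgf M t"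
    using M by (simp add: has_fcgf_def)
  then obtain e where e: "e > 0" "\<And>t. t \<in> analytic_dom (tilt C \<theta>) \<Longrightarrow> t \<noteq> 0 \<Longrightarrow> \<bar>t\<bar> < e \<Longrightarrow>
      t \<in> fcgf_dom M \<and> tilt C \<theta> t = fcgf M t"
    unfolding eventually_at by (auto simp: dist_real_def)
  interpret real_distribution M using M by (simp add: has_fcgf_def)
  have "(powr) 1 = (\<lambda>x::real. 1::real)" by auto
  then have "0 \<in> fcgf_dom M \<and> tilt C \<theta> 0 = fcgf M 0"
    by (simp add: fcgf_dom_def fcgf_def tilt_def prob_space[simplified])
  moreover have "t \<in> analytic_dom (tilt C \<theta>)" if "\<bar>t\<bar> < d" for t
    using sub that by (auto simp: dist_real_def)
  ultimately have "t \<in> fcgf_dom M \<and> tilt C \<theta> t = fcgf M t" if "\<bar>t\<bar> < min d e" for t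
    using e(2)[of t] that by (cases "t = 0") auto
  then show ?thesis using d(1) e(1) by (intro that[of "min d e"]) auto
qed

text \<open>Near zero \<open>K\<close> is the composition of the logarithm, the holomorphic Laplace transform and
  \<open>t \<mapsto> ln (1 + t)\<close>; the transform has positive real part near zero, where its value is one.\<close>

lemma fcgf_real_analytic_at_zero:
  assumes M: "real_distribution M" and e: "e > 0"
    and K: "\<And>t. \<bar>t\<bar> < e \<Longrightarrow> t \<in> fcgf_dom M \<and> exp (K t) = (\<integral>x. exp (ln (1 + t) * x) \<partial>M)"
  shows "real_analytic_at K 0"
proof -
  interpret real_distribution M by fact
  let ?L = "\<lambda>z. \<integral>x. exp (z * complex_of_real x) \<partial>M"
  have "isCont (\<lambda>s::real. exp s - 1) 0" by (intro continuous_intros)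
  then obtain \<eta> where \<eta>: "\<eta> > 0" "\<And>s::real. \<bar>s\<bar> < \<eta> \<Longrightarrow> \<bar>exp s - 1\<bar> < e"
    using e unfolding continuous_at_eps_delta by (auto simp: dist_real_def)
  have int: "integrable M (\<lambda>x. exp (s * x))" if "\<bar>s - 0\<bar> < \<eta>" for s
    using K[OF \<eta>(2)[of s]] that by (simp add: mem_fcgf_dom_iff)
  have holL: "?L holomorphic_on {z. \<bar>Re z - 0\<bar> < \<eta>}"
    by (rule laplace_holomorphic[OF M \<eta>(1) int])
  have Ln_hol: "(\<lambda>z. Ln (1 + z)) holomorphic_on ball 0 1"
  proof (intro holomorphic_intros)
    fix z :: complex assume "z \<in> ball 0 1"
    then have "Re (1 + z) > 0" using abs_Re_le_cmod[of z] by (simp add: dist_norm)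
    then show "1 + z \<notin> \<real>\<^sub>\<le>\<^sub>0" using complex_nonpos_Reals_iff by force
  qed
  define U where "U = ball 0 1 \<inter> (\<lambda>z. Ln (1 + z)) -` {z. \<bar>Re z - 0\<bar> < \<eta>}"
  have U: "open U" unfolding U_def
    by (intro continuous_open_preimage holomorphic_on_imp_continuous_on Ln_hol open_strip) simp
  let ?G = "\<lambda>z. ?L (Ln (1 + z))"
  have holG: "?G holomorphic_on U"
    using holomorphic_on_compose_gen[OF holomorphic_on_subset[OF Ln_hol] holL, of U]
    by (auto simp: U_def o_def)
  define V where "V = U \<inter> ?G -` {z. Re z > 0}"
  have V: "open V" unfolding V_def
    by (intro continuous_open_preimage holomorphic_on_imp_continuous_on holG U open_halfspace_Re_gt)
  have "0 \<in> V" using \<eta>(1) by (simp add: V_def U_def prob_space[simplified])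
  then obtain r where r: "r > 0" "ball 0 r \<subseteq> V" using V open_contains_ball by blast
  show ?thesis
  proof (rule real_analytic_at_if_Re_holomorphic)
    show "min r (min e 1) > 0" using r(1) e by simp
    have "(\<lambda>z. Ln (?G z)) holomorphic_on V"
    proof (intro holomorphic_intros)
      show "?G holomorphic_on V" using holG by (rule holomorphic_on_subset) (auto simp: V_def)
      show "?G z \<notin> \<real>\<^sub>\<le>\<^sub>0" if "z \<in> V" for z
        using that complex_nonpos_Reals_iff[of "?G z"] by (force simp: V_def)
    qed
    then show "(\<lambda>z. Ln (?G z)) holomorphic_on ball (complex_of_real 0) (min r (min e 1))"
      by (rule holomorphic_on_subset) (use r(2) in auto)
    fix t :: real assume t: "\<bar>t - 0\<bar> < min r (min e 1)"
    have "Ln (1 + complex_of_real t) = of_real (ln (1 + t))"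
    proof -
      have "1 + t > 0" using t by linarith
      then show ?thesis using Ln_of_real[of "1 + t"] by simp
    qed
    then have "?G (of_real t) = of_real (exp (K t))"
      using K[of t] t by (simp add: laplace_of_real)
    then have "Ln (?G (of_real t)) = of_real (K t)"
      using Ln_of_real[of "exp (K t)"] by simp
    then show "K t = Re (Ln (?G (of_real t)))" by simp
  qed
qed

lemma has_fcgfI:
  assumes M: "real_distribution M" and e: "e > 0"
    and K: "\<And>t. \<bar>t\<bar> < e \<Longrightarrow> t \<in> fcgf_dom M \<and> exp (K t) = (\<integral>x. exp (ln (1 + t) * x) \<partial>M)"
  shows "has_fcgf M K"
proof -
  have eq: "t \<in> fcgf_dom M \<and> K t = fcgf M t" if "\<bar>t\<bar> < e" for t
    using K[OF that] exp_fcgf[OF M, of t] by (metis exp_inj_iff)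
  have "ball 0 e \<subseteq> fcgf_dom M" using eq by (auto simp: dist_real_def)
  then have "ball 0 e \<subseteq> interior (fcgf_dom M)" by (intro interior_maximal) auto
  then have "0 \<in> interior (fcgf_dom M)" using e by auto
  moreover have "\<forall>\<^sub>F t in at 0 within analytic_dom K. t \<in> fcgf_dom M \<and> K t = fcgf M t"
    unfolding eventually_at using e eq by (intro exI[of _ e]) (auto simp: dist_real_def)
  ultimately show ?thesis using M by (auto simp: has_fcgf_def)
qed

section \<open>The mean along a factorial tilting family\<close>

lemma abs_diff_le_if_deriv_bounded:
  fixes f :: "real \<Rightarrow> real"
  assumes cont: "continuous_on {lo..hi} f"
    and deriv: "\<And>z. lo < z \<Longrightarrow> z < hi \<Longrightarrow> (f has_real_derivative f' z) (at z) \<and> \<bar>f' z\<bar> \<le> B"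
    and xy: "x \<in> {lo..hi}" "y \<in> {lo..hi}"
  shows "\<bar>f x - f y\<bar> \<le> B * \<bar>x - y\<bar>"
proof -
  have *: "\<bar>f v - f u\<bar> \<le> B * \<bar>v - u\<bar>" if uv: "lo \<le> u" "u < v" "v \<le> hi" for u v
  proof -
    have "\<exists>l z. u < z \<and> z < v \<and> (f has_real_derivative l) (at z) \<and> f v - f u = (v - u) * l"
      using uv deriv by (intro MVT continuous_on_subset[OF cont])
        (auto simp: real_differentiable_def, meson less_le_trans le_less_trans)
    then obtain l z where z: "u < z" "z < v" "(f has_real_derivative l) (at z)" "f v - f u = (v - u) * l"
      by blast
    have "l = f' z" and "\<bar>f' z\<bar> \<le> B" using deriv[of z] z uv DERIV_unique by auto
    then show ?thesis using z(4) uv by (simp add: abs_mult mult.commute mult_right_mono)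
  qed
  show ?thesis
  proof (cases x y rule: linorder_cases)
    case less
    then show ?thesis using *[of x y] xy by (simp add: abs_minus_commute)
  next
    case greater
    then show ?thesis using *[of y x] xy by simp
  qed simp
qed

lemma locally_dispersed_derivs:
  assumes C: "C \<in> fcgfs" and ld: "locally_dispersed C \<Theta> C1 C2" and \<theta>: "\<theta> \<in> interior \<Theta>"
  shows "real_analytic_at C \<theta>" "(C has_real_derivative C1 \<theta>) (at \<theta>)"
    "(C1 has_real_derivative C2 \<theta>) (at \<theta>)"
proof -
  have "interior \<Theta> \<subseteq> interior (analytic_dom C)"
    using ld by (intro interior_mono) (simp add: locally_dispersed_def)
  then show an: "real_analytic_at C \<theta>"
    using C \<theta> by (auto simp: fcgfs_def analytic_funs_def analytic_interval_def)
  have eq: "C1 s = deriv C s" "C2 s = deriv (deriv C) s" if "s \<in> interior \<Theta>" for s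
    using ld that by (auto simp: locally_dispersed_def)
  show "(C has_real_derivative C1 \<theta>) (at \<theta>)"
    using real_analytic_at_derivs(2)[OF an] eq(1)[OF \<theta>] by (simp add: DERIV_deriv_iff_field_differentiable)
  have "(deriv C has_real_derivative C2 \<theta>) (at \<theta>)"
    using real_analytic_at_derivs(2)[OF real_analytic_at_derivs(1)[OF an]] eq(2)[OF \<theta>]
    by (simp add: DERIV_deriv_iff_field_differentiable)
  moreover have "\<forall>\<^sub>F s in nhds \<theta>. deriv C s = C1 s"
    using eventually_nhds_in_open[OF open_interior \<theta>] by eventually_elim (simp add: eq)
  ultimately show "(C1 has_real_derivative C2 \<theta>) (at \<theta>)"
    by (simp cong: DERIV_cong_ev)
qed

lemma locally_dispersed_strict_mono_or_antimono:
  assumes C: "C \<in> fcgfs" and ld: "locally_dispersed C \<Theta> C1 C2"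
  shows "(\<forall>x\<in>\<Theta>. \<forall>y\<in>\<Theta>. x < y \<longrightarrow> C1 x < C1 y) \<or> (\<forall>x\<in>\<Theta>. \<forall>y\<in>\<Theta>. x < y \<longrightarrow> C1 x > C1 y)"
proof -
  have int: "is_interval \<Theta>" and cont: "continuous_on \<Theta> C1"
    using ld by (auto simp: locally_dispersed_def)
  have sub: "{x..y} \<subseteq> \<Theta>" "{x<..<y} \<subseteq> interior \<Theta>" if "x \<in> \<Theta>" "y \<in> \<Theta>" for x y
  proof -
    show *: "{x..y} \<subseteq> \<Theta>" using mem_is_interval_1_I[OF int that] by auto
    show "{x<..<y} \<subseteq> interior \<Theta>" using * by (intro interior_maximal) auto
  qed
  have "(\<forall>\<theta>\<in>\<Theta>. C2 \<theta> > 0) \<or> (\<forall>\<theta>\<in>\<Theta>. C2 \<theta> < 0)"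
    using ld by (auto simp: locally_dispersed_def)
  then show ?thesis
  proof
    assume pos: "\<forall>\<theta>\<in>\<Theta>. C2 \<theta> > 0"
    have "C1 x < C1 y" if "x \<in> \<Theta>" "y \<in> \<Theta>" "x < y" for x y
    proof (rule DERIV_pos_imp_increasing_open[OF that(3)])
      fix z assume "x < z" "z < y"
      then have "z \<in> interior \<Theta>" using sub(2)[OF that(1,2)] by auto
      then show "\<exists>d. (C1 has_real_derivative d) (at z) \<and> d > 0"
        using locally_dispersed_derivs(3)[OF C ld] pos interior_subset by blast
    qed (rule continuous_on_subset[OF cont sub(1)[OF that(1,2)]])
    then show ?thesis by blast
  next
    assume neg: "\<forall>\<theta>\<in>\<Theta>. C2 \<theta> < 0"
    have "C1 x > C1 y" if "x \<in> \<Theta>" "y \<in> \<Theta>" "x < y" for x y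
    proof (rule DERIV_neg_imp_decreasing_open[OF that(3)])
      fix z assume "x < z" "z < y"
      then have "z \<in> interior \<Theta>" using sub(2)[OF that(1,2)] by auto
      then show "\<exists>d. (C1 has_real_derivative d) (at z) \<and> d < 0"
        using locally_dispersed_derivs(3)[OF C ld] neg interior_subset by blast
    qed (rule continuous_on_subset[OF cont sub(1)[OF that(1,2)]])
    then show ?thesis by blast
  qed
qed

text \<open>On a compact interval of parameters the injective function \<open>C1\<close> has a continuous inverse.\<close>

lemma local_dispersion_continuous:
  assumes "local_tilting_family FT \<Psi> v" and sub: "{a..b} \<subseteq> \<Psi>"
  shows "continuous_on {a..b} v"
proof (cases "a \<le> b")
  case True
  obtain C \<Theta> C1 C2 where C: "C \<in> fcgfs" and ld: "locally_dispersed C \<Theta> C1 C2"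
    and \<Psi>: "\<Psi> = C1 ` \<Theta>" and v: "\<And>\<theta>. \<theta> \<in> \<Theta> \<Longrightarrow> v (C1 \<theta>) = C2 \<theta>"
    using assms(1) unfolding local_tilting_family_def by blast
  have int: "is_interval \<Theta>" and cont: "continuous_on \<Theta> C1" "continuous_on \<Theta> C2"
    using ld by (auto simp: locally_dispersed_def)
  have "a \<in> C1 ` \<Theta>" "b \<in> C1 ` \<Theta>" using True sub by (auto simp: \<Psi>)
  then obtain \<alpha> \<beta> where \<alpha>: "\<alpha> \<in> \<Theta>" "C1 \<alpha> = a" and \<beta>: "\<beta> \<in> \<Theta>" "C1 \<beta> = b" by auto
  let ?J = "closed_segment \<alpha> \<beta>"
  have J: "?J \<subseteq> \<Theta>" using \<alpha> \<beta> int by (intro closed_segment_subset) (auto simp: is_interval_convex_1)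
  have inj: "inj_on C1 ?J"
    using locally_dispersed_strict_mono_or_antimono[OF C ld] J
    by (intro linorder_inj_onI') (metis less_irrefl subsetD)
  have "continuous_on (C1 ` ?J) (\<lambda>m. C2 (the_inv_into ?J C1 m))"
    using J by (intro continuous_on_compose2[OF continuous_on_subset[OF cont(2) J]]
        continuous_on_inv continuous_on_subset[OF cont(1) J])
      (auto simp: the_inv_into_f_f[OF inj])
  then have "continuous_on (C1 ` ?J) v"
    by (rule continuous_on_eq) (use v J the_inv_into_f_f[OF inj] in auto)
  moreover have "{a..b} \<subseteq> C1 ` ?J"
  proof (rule connected_contains_Icc)
    show "connected (C1 ` ?J)"
      by (intro connected_continuous_image continuous_on_subset[OF cont(1) J]) simp
  qed (use \<alpha> \<beta> in auto)
  ultimately show ?thesis by (rule continuous_on_subset)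
qed simp

text \<open>The mean \<open>C1\<close> satisfies \<open>C1' = v \<circ> C1\<close>.  Hence \<open>\<psi> \<circ> C1\<close> has derivative \<open>\<psi>' v \<approx> c\<close> as long as \<open>C1\<close>
  stays in \<open>[a, b]\<close>, and \<open>\<psi> (C1 (\<theta> + t))\<close> stays within \<open>\<epsilon> * \<bar>t\<bar>\<close> of \<open>\<psi> \<mu> + c * t = \<psi> (X t)\<close>.  Before \<open>C1\<close> can reach
  \<open>a\<close> or \<open>b\<close>, the parameter has to move by at least \<open>\<bar>\<psi> a - \<psi> \<mu>\<bar> / (c + 1)\<close> or
  \<open>\<bar>\<psi> b - \<psi> \<mu>\<bar> / (c + 1)\<close>, which is why \<open>d\<close> can be chosen independently of the family.  The inverse Lipschitz
  constant \<open>L\<close> of \<open>\<psi>\<close> turns closeness of \<open>\<psi> \<circ> C1\<close> and \<open>\<psi> \<circ> X\<close> into closeness of \<open>C1\<close> and \<open>X\<close>.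

  The pairs of interest are \<open>\<psi>' = 1 / lim v\<^sub>n\<close>, \<open>c = 1\<close> and \<open>\<psi> = id\<close>, \<open>c = 0\<close>.\<close>

lemma tilt_near_ode_solution:
  assumes C: "C \<in> fcgfs" and ld: "locally_dispersed C \<Theta> C1 C2"
    and v: "\<And>\<theta>. \<theta> \<in> \<Theta> \<Longrightarrow> v (C1 \<theta>) = C2 \<theta>"
    and \<theta>: "\<theta> \<in> \<Theta>" "C1 \<theta> = \<mu>" and ab: "a < \<mu>" "\<mu> < b" "a \<in> C1 ` \<Theta>" "b \<in> C1 ` \<Theta>"
    and \<psi>: "\<And>m. m \<in> {a..b} \<Longrightarrow> (\<psi> has_real_derivative \<psi>' m) (at m)"
    and close: "\<And>m. m \<in> {a..b} \<Longrightarrow> \<bar>\<psi>' m * v m - c\<bar> \<le> \<epsilon>" and c: "c \<ge> 0" and \<epsilon>: "0 \<le> \<epsilon>" "\<epsilon> \<le> 1"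
    and d: "d > 0" "(c + 1) * d \<le> \<bar>\<psi> a - \<psi> \<mu>\<bar>" "(c + 1) * d \<le> \<bar>\<psi> b - \<psi> \<mu>\<bar>"
    and L: "L \<ge> 0" "\<And>m m'. m \<in> {a..b} \<Longrightarrow> m' \<in> {a..b} \<Longrightarrow> \<bar>m - m'\<bar> \<le> L * \<bar>\<psi> m - \<psi> m'\<bar>"
    and X: "\<And>t. \<bar>t\<bar> < d \<Longrightarrow> X t \<in> {a..b} \<and> \<psi> (X t) = \<psi> \<mu> + c * t"
    and K: "K 0 = 0" "\<And>t. \<bar>t\<bar> < d \<Longrightarrow> (K has_real_derivative X t) (at t)"
    and t: "\<bar>t\<bar> < d"
  shows "\<theta> + t \<in> interior \<Theta>" and "\<bar>tilt C \<theta> t - K t\<bar> \<le> L * \<epsilon> * d * d"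
proof -
  obtain \<alpha> \<beta> where \<alpha>: "\<alpha> \<in> \<Theta>" "C1 \<alpha> = a" and \<beta>: "\<beta> \<in> \<Theta>" "C1 \<beta> = b" using ab by blast
  have int: "is_interval \<Theta>" and cont: "continuous_on \<Theta> C1"
    using ld by (auto simp: locally_dispersed_def)
  define lo hi where "lo = min \<alpha> \<beta>" and "hi = max \<alpha> \<beta>"
  have lohi: "lo \<in> \<Theta>" "hi \<in> \<Theta>" using \<alpha> \<beta> by (auto simp: lo_def hi_def min_def max_def)
  have sub: "{lo..hi} \<subseteq> \<Theta>" using mem_is_interval_1_I[OF int lohi] by auto
  have sub_int: "{lo<..<hi} \<subseteq> interior \<Theta>" using sub by (intro interior_maximal) auto
  have mono: "lo < \<theta> \<and> \<theta> < hi \<and> (\<forall>s\<in>{lo..hi}. C1 s \<in> {a..b})"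
    using locally_dispersed_strict_mono_or_antimono[OF C ld]
  proof
    assume m: "\<forall>x\<in>\<Theta>. \<forall>y\<in>\<Theta>. x < y \<longrightarrow> C1 x < C1 y"
    have "\<alpha> < \<theta>" using m[rule_format, of \<theta> \<alpha>] \<alpha> \<theta> ab(1) by (cases \<alpha> \<theta> rule: linorder_cases) auto
    moreover have "\<theta> < \<beta>" using m[rule_format, of \<beta> \<theta>] \<beta> \<theta> ab(2) by (cases \<beta> \<theta> rule: linorder_cases) auto
    moreover from calculation have "s \<in> \<Theta>" if "s \<in> {\<alpha>..\<beta>}" for s
      using that sub by (auto simp: lo_def hi_def)
    then have "C1 s \<in> {a..b}" if "s \<in> {\<alpha>..\<beta>}" for s
      using m[rule_format, of \<alpha> s] m[rule_format, of s \<beta>] \<alpha> \<beta> that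
      by (cases "s = \<alpha>"; cases "s = \<beta>") auto
    ultimately show ?thesis by (simp add: lo_def hi_def)
  next
    assume m: "\<forall>x\<in>\<Theta>. \<forall>y\<in>\<Theta>. x < y \<longrightarrow> C1 x > C1 y"
    have "\<beta> < \<theta>" using m[rule_format, of \<theta> \<beta>] \<beta> \<theta> ab(2) by (cases \<beta> \<theta> rule: linorder_cases) auto
    moreover have "\<theta> < \<alpha>" using m[rule_format, of \<alpha> \<theta>] \<alpha> \<theta> ab(1) by (cases \<alpha> \<theta> rule: linorder_cases) auto
    moreover from calculation have "s \<in> \<Theta>" if "s \<in> {\<beta>..\<alpha>}" for s
      using that sub by (auto simp: lo_def hi_def)
    then have "C1 s \<in> {a..b}" if "s \<in> {\<beta>..\<alpha>}" for s
      using m[rule_format, of \<beta> s] m[rule_format, of s \<alpha>] \<alpha> \<beta> that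
      by (cases "s = \<alpha>"; cases "s = \<beta>") auto
    ultimately show ?thesis by (simp add: lo_def hi_def)
  qed
  \<comment> \<open>\<open>\<psi> \<circ> C1\<close> runs at speed \<open>c\<close> up to an error \<open>\<epsilon>\<close>.\<close>
  have drift: "\<bar>(\<psi> (C1 s) - c * s) - (\<psi> (C1 \<theta>) - c * \<theta>)\<bar> \<le> \<epsilon> * \<bar>s - \<theta>\<bar>" if s: "s \<in> {lo..hi}" for s
  proof (rule abs_diff_le_if_deriv_bounded[where f = "\<lambda>s. \<psi> (C1 s) - c * s"
        and f' = "\<lambda>z. \<psi>' (C1 z) * v (C1 z) - c"])
    have "continuous_on {a..b} \<psi>"
      using \<psi> by (intro continuous_at_imp_continuous_on ballI DERIV_isCont)
    then have "continuous_on {lo..hi} (\<lambda>s. \<psi> (C1 s))"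
      by (rule continuous_on_compose2) (use continuous_on_subset[OF cont sub] mono in auto)
    then show "continuous_on {lo..hi} (\<lambda>s. \<psi> (C1 s) - c * s)"
      by (intro continuous_intros)
    fix z assume z: "lo < z" "z < hi"
    then have z': "z \<in> interior \<Theta>" "z \<in> \<Theta>" "C1 z \<in> {a..b}" using sub_int sub mono by auto
    have "((\<lambda>s. \<psi> (C1 s) - c * s) has_real_derivative \<psi>' (C1 z) * C2 z - c) (at z)"
      using DERIV_chain2[OF \<psi>[OF z'(3)] locally_dispersed_derivs(3)[OF C ld z'(1)]]
      by (auto intro!: derivative_eq_intros)
    then show "((\<lambda>s. \<psi> (C1 s) - c * s) has_real_derivative \<psi>' (C1 z) * v (C1 z) - c) (at z) \<and>
        \<bar>\<psi>' (C1 z) * v (C1 z) - c\<bar> \<le> \<epsilon>"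
      using close[OF z'(3)] v[OF z'(2)] by simp
  qed (use s mono in auto)
  have far: "d \<le> \<bar>s - \<theta>\<bar>" if s: "s \<in> {lo..hi}" and le: "(c + 1) * d \<le> \<bar>\<psi> (C1 s) - \<psi> \<mu>\<bar>" for s
  proof -
    have "\<bar>\<psi> (C1 s) - \<psi> \<mu>\<bar> \<le> \<bar>c * (s - \<theta>)\<bar> + \<epsilon> * \<bar>s - \<theta>\<bar>"
      using drift[OF s] \<theta>(2) by (simp add: algebra_simps)
    also have "\<dots> \<le> c * \<bar>s - \<theta>\<bar> + 1 * \<bar>s - \<theta>\<bar>"
      using c \<epsilon> by (intro add_mono mult_right_mono) (auto simp: abs_mult)
    finally have "(c + 1) * d \<le> (c + 1) * \<bar>s - \<theta>\<bar>" using le by (simp add: distrib_right)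
    then show ?thesis using c by simp
  qed
  have "d \<le> \<bar>\<alpha> - \<theta>\<bar>" "d \<le> \<bar>\<beta> - \<theta>\<bar>"
    using far[of \<alpha>] far[of \<beta>] d \<alpha> \<beta> by (auto simp: lo_def hi_def)
  then have room: "lo \<le> \<theta> - d" "\<theta> + d \<le> hi"
    using mono by (auto simp: lo_def hi_def min_def max_def split: if_splits)
  have inside: "\<theta> + u \<in> {lo<..<hi}" if "\<bar>u\<bar> < d" for u using room that by auto
  show "\<theta> + t \<in> interior \<Theta>" using inside[OF t] sub_int by auto
  have "\<bar>(tilt C \<theta> t - K t) - (tilt C \<theta> 0 - K 0)\<bar> \<le> (L * \<epsilon> * d) * \<bar>t - 0\<bar>"
  proof (rule abs_diff_le_if_deriv_bounded[where f = "\<lambda>u. tilt C \<theta> u - K u"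
        and f' = "\<lambda>u. C1 (\<theta> + u) - X u" and lo = "-\<bar>t\<bar>" and hi = "\<bar>t\<bar>"])
    have der: "((\<lambda>u. tilt C \<theta> u - K u) has_real_derivative C1 (\<theta> + u) - X u) (at u)" if "\<bar>u\<bar> < d" for u
    proof -
      have "(C has_real_derivative C1 (\<theta> + u)) (at (u + \<theta>))"
        using inside[OF that] sub_int locally_dispersed_derivs(2)[OF C ld, of "\<theta> + u"]
        by (auto simp: add.commute)
      then have "((\<lambda>u. C (\<theta> + u)) has_real_derivative C1 (\<theta> + u)) (at u)"
        unfolding DERIV_shift by (simp add: add.commute)
      then show ?thesis
        unfolding tilt_def using K(2)[OF that] by (auto intro!: derivative_eq_intros)
    qed
    show "continuous_on {-\<bar>t\<bar>..\<bar>t\<bar>} (\<lambda>u. tilt C \<theta> u - K u)"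
      using t by (intro continuous_at_imp_continuous_on ballI DERIV_isCont[OF der]) auto
    fix u assume "-\<bar>t\<bar> < u" "u < \<bar>t\<bar>"
    then have u: "\<bar>u\<bar> < d" using t by linarith
    have "\<theta> + u \<in> {lo..hi}" using inside[OF u] by auto
    then have "C1 (\<theta> + u) \<in> {a..b}" and "\<bar>\<psi> (C1 (\<theta> + u)) - \<psi> (X u)\<bar> \<le> \<epsilon> * \<bar>u\<bar>"
      using mono drift[of "\<theta> + u"] X[OF u] \<theta>(2) by (auto simp: algebra_simps)
    then have "\<bar>C1 (\<theta> + u) - X u\<bar> \<le> L * (\<epsilon> * \<bar>u\<bar>)"
      using L X[OF u] by (meson mult_left_mono order_trans)
    also have "\<dots> \<le> L * \<epsilon> * d"
      using L(1) \<epsilon>(1) u by (simp add: mult.assoc mult_left_mono)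
    finally show "((\<lambda>u. tilt C \<theta> u - K u) has_real_derivative C1 (\<theta> + u) - X u) (at u) \<and>
        \<bar>C1 (\<theta> + u) - X u\<bar> \<le> L * \<epsilon> * d"
      using der[OF u] by simp
  qed auto
  also have "\<dots> \<le> L * \<epsilon> * d * d"
    using L(1) \<epsilon>(1) d(1) t by (intro mult_left_mono) auto
  finally show "\<bar>tilt C \<theta> t - K t\<bar> \<le> L * \<epsilon> * d * d"
    using K(1) by (simp add: tilt_def)
qed

text \<open>Comparison with the limiting differential equation gives \<open>tilt C\<^sub>n \<theta>\<^sub>n \<rightarrow> K\<close> on a fixed interval; analytic
  continuation turns this into convergence of the Laplace transforms of \<open>FT n \<mu>\<close> in a fixed
  neighbourhood of zero, for all sufficiently large \<open>n\<close>.\<close>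

lemma tilting_families_weak_limit:
  assumes fam: "\<And>n. local_tilting_family (FT n) (\<Psi> n) (vn n)"
    and ab: "a < \<mu>" "\<mu> < b" "\<And>n. {a..b} \<subseteq> \<Psi> n"
    and \<psi>: "\<And>m. m \<in> {a..b} \<Longrightarrow> (\<psi> has_real_derivative \<psi>' m) (at m)"
    and unif: "uniform_limit {a..b} (\<lambda>n m. \<psi>' m * vn n m) (\<lambda>_. c) sequentially" and c: "c \<ge> 0"
    and L: "L \<ge> 0" "\<And>m m'. m \<in> {a..b} \<Longrightarrow> m' \<in> {a..b} \<Longrightarrow> \<bar>m - m'\<bar> \<le> L * \<bar>\<psi> m - \<psi> m'\<bar>"
    and d0: "d0 > 0" and X: "\<And>t. \<bar>t\<bar> < d0 \<Longrightarrow> X t \<in> {a..b} \<and> \<psi> (X t) = \<psi> \<mu> + c * t"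
    and K: "K 0 = 0" "\<And>t. \<bar>t\<bar> < d0 \<Longrightarrow> (K has_real_derivative X t) (at t)"
  obtains M e where "real_distribution M" "weak_conv_m (\<lambda>n. FT n \<mu>) M" "e > 0"
    "\<And>t. \<bar>t\<bar> < e \<Longrightarrow> t \<in> fcgf_dom M \<and> exp (K t) = (\<integral>x. exp (ln (1 + t) * x) \<partial>M)"
proof -
  \<comment> \<open>\<open>d \<le> 1\<close> keeps \<open>1 + t\<close> positive; the quotients keep the mean inside \<open>[a, b]\<close>.\<close>
  define d where "d = min (min d0 1) (min (\<bar>\<psi> a - \<psi> \<mu>\<bar> / (c + 1)) (\<bar>\<psi> b - \<psi> \<mu>\<bar> / (c + 1)))"
  have "\<bar>\<psi> a - \<psi> \<mu>\<bar> > 0" "\<bar>\<psi> b - \<psi> \<mu>\<bar> > 0"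
    using L(2)[of a \<mu>] L(2)[of b \<mu>] ab(1,2) by auto
  then have "\<bar>\<psi> a - \<psi> \<mu>\<bar> / (c + 1) > 0" "\<bar>\<psi> b - \<psi> \<mu>\<bar> / (c + 1) > 0"
    using c by (intro divide_pos_pos; simp)+
  then have d: "d > 0" "d \<le> 1" "d \<le> d0"
    "d \<le> \<bar>\<psi> a - \<psi> \<mu>\<bar> / (c + 1)" "d \<le> \<bar>\<psi> b - \<psi> \<mu>\<bar> / (c + 1)"
    using d0 unfolding d_def by (simp_all only: min_less_iff_conj min_le_iff_disj order_refl simp_thms zero_less_one)
  then have d': "(c + 1) * d \<le> \<bar>\<psi> a - \<psi> \<mu>\<bar>" "(c + 1) * d \<le> \<bar>\<psi> b - \<psi> \<mu>\<bar>"
    using c by (auto simp: le_divide_eq mult.commute)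
  have "\<exists>C \<theta>. has_fcgf (FT n \<mu>) (tilt C \<theta>) \<and> (\<forall>\<epsilon>. 0 \<le> \<epsilon> \<longrightarrow> \<epsilon> \<le> 1 \<longrightarrow>
      (\<forall>m\<in>{a..b}. \<bar>\<psi>' m * vn n m - c\<bar> \<le> \<epsilon>) \<longrightarrow>
      (\<forall>t. \<bar>t\<bar> < d \<longrightarrow> t \<in> fcgf_dom (FT n \<mu>) \<and>
        exp (tilt C \<theta> t) = (\<integral>x. exp (ln (1 + t) * x) \<partial>FT n \<mu>) \<and>
        \<bar>tilt C \<theta> t - K t\<bar> \<le> L * \<epsilon> * d * d))" for n
  proof -
    obtain C \<Theta> C1 C2 where C: "C \<in> fcgfs" and ld: "locally_dispersed C \<Theta> C1 C2"
      and \<Psi>: "\<Psi> n = C1 ` \<Theta>"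
      and tilts: "\<And>\<theta>. \<theta> \<in> \<Theta> \<Longrightarrow> has_fcgf (FT n (C1 \<theta>)) (tilt C \<theta>)"
      and v: "\<And>\<theta>. \<theta> \<in> \<Theta> \<Longrightarrow> vn n (C1 \<theta>) = C2 \<theta>"
      using fam[of n] unfolding local_tilting_family_def by blast
    have "\<mu> \<in> C1 ` \<Theta>" "a \<in> C1 ` \<Theta>" "b \<in> C1 ` \<Theta>"
      using ab(1,2) ab(3)[of n] by (auto simp: \<Psi>)
    then obtain \<theta> where \<theta>: "\<theta> \<in> \<Theta>" "C1 \<theta> = \<mu>" by blast
    have fcgf: "has_fcgf (FT n \<mu>) (tilt C \<theta>)" using tilts[OF \<theta>(1)] \<theta>(2) by simp
    show ?thesis
    proof (rule exI[of _ C], rule exI[of _ \<theta>], intro conjI fcgf allI impI)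
      fix \<epsilon> t :: real
      assume \<epsilon>: "0 \<le> \<epsilon>" "\<epsilon> \<le> 1" and close: "\<forall>m\<in>{a..b}. \<bar>\<psi>' m * vn n m - c\<bar> \<le> \<epsilon>"
        and t: "\<bar>t\<bar> < d"
      have near: "\<theta> + u \<in> interior \<Theta> \<and> \<bar>tilt C \<theta> u - K u\<bar> \<le> L * \<epsilon> * d * d" if "\<bar>u\<bar> < d" for u
        using tilt_near_ode_solution[OF C ld v \<theta> ab(1,2) \<open>a \<in> C1 ` \<Theta>\<close> \<open>b \<in> C1 ` \<Theta>\<close> \<psi> _ c \<epsilon>
            d(1) d' L X K that] close d(3) by simp
      then show "\<bar>tilt C \<theta> t - K t\<bar> \<le> L * \<epsilon> * d * d" using t by blast
      have "\<theta> \<in> interior (analytic_dom C)"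
        using near[of 0] d(1) ld interior_mono[of \<Theta>] by (auto simp: locally_dispersed_def)
      then obtain e where e: "e > 0"
        "\<And>t. \<bar>t\<bar> < e \<Longrightarrow> t \<in> fcgf_dom (FT n \<mu>) \<and> tilt C \<theta> t = fcgf (FT n \<mu>) t"
        using tilt_eq_fcgf_near_zero[OF C _ fcgf] by blast
      have "real_analytic_at (tilt C \<theta>) u" if "\<bar>u\<bar> < d" for u
        using near[OF that] by (intro real_analytic_at_tilt locally_dispersed_derivs(1)[OF C ld]) auto
      then show "t \<in> fcgf_dom (FT n \<mu>)"
          "exp (tilt C \<theta> t) = (\<integral>x. exp (ln (1 + t) * x) \<partial>FT n \<mu>)"
        using fcgf_eq_analytic_continuation[OF _ d(1,2) e(1) e(2) _ t] fcgf
        by (auto simp: has_fcgf_def)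
    qed
  qed
  then obtain C \<theta> where fcgf: "\<And>n. has_fcgf (FT n \<mu>) (tilt (C n) (\<theta> n))"
    and near: "\<And>n \<epsilon> t. 0 \<le> \<epsilon> \<Longrightarrow> \<epsilon> \<le> 1 \<Longrightarrow> (\<forall>m\<in>{a..b}. \<bar>\<psi>' m * vn n m - c\<bar> \<le> \<epsilon>) \<Longrightarrow> \<bar>t\<bar> < d \<Longrightarrow>
      t \<in> fcgf_dom (FT n \<mu>) \<and> exp (tilt (C n) (\<theta> n) t) = (\<integral>x. exp (ln (1 + t) * x) \<partial>FT n \<mu>) \<and>
        \<bar>tilt (C n) (\<theta> n) t - K t\<bar> \<le> L * \<epsilon> * d * d"
    by metis
  have close: "\<forall>\<^sub>F n in sequentially. \<forall>m\<in>{a..b}. \<bar>\<psi>' m * vn n m - c\<bar> \<le> \<epsilon>" if "\<epsilon> > 0" for \<epsilon>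
    using uniform_limitD[OF unif that] by eventually_elim (auto simp: dist_real_def less_imp_le)
  obtain N where N: "\<And>n. n \<ge> N \<Longrightarrow> \<forall>m\<in>{a..b}. \<bar>\<psi>' m * vn n m - c\<bar> \<le> 1"
    using close[of 1] by (auto simp: eventually_sequentially)
  have lim: "(\<lambda>n. tilt (C n) (\<theta> n) t) \<longlonglongrightarrow> K t" if t: "\<bar>t\<bar> < d" for t
  proof (rule tendstoI)
    fix r :: real assume r: "r > 0"
    define \<epsilon> where "\<epsilon> = min 1 (r / (L * d * d + 1))"
    have pos: "L * d * d + 1 > 0" using L(1) d(1) by (simp add: add_nonneg_pos)
    then have \<epsilon>: "\<epsilon> > 0" "\<epsilon> \<le> 1" using r by (auto simp: \<epsilon>_def)
    have "L * \<epsilon> * d * d < (L * d * d + 1) * \<epsilon>" using \<epsilon> by (simp add: algebra_simps)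
    also have "\<dots> \<le> (L * d * d + 1) * (r / (L * d * d + 1))"
      using pos by (intro mult_left_mono) (auto simp: \<epsilon>_def)
    also have "\<dots> = r" using pos by simp
    finally have "L * \<epsilon> * d * d < r" .
    then show "\<forall>\<^sub>F n in sequentially. dist (tilt (C n) (\<theta> n) t) (K t) < r"
      using close[OF \<epsilon>(1)] near[OF less_imp_le[OF \<epsilon>(1)] \<epsilon>(2) _ t]
      by (auto elim!: eventually_mono simp: dist_real_def intro: le_less_trans)
  qed
  have cont: "isCont (\<lambda>s::real. exp s - 1) 0" "isCont (\<lambda>t::real. ln (1 + t)) 0"
    by (intro continuous_intros; simp)+
  obtain \<eta> where \<eta>: "\<eta> > 0" "\<And>s::real. \<bar>s\<bar> < \<eta> \<Longrightarrow> \<bar>exp s - 1\<bar> < d"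
    using cont(1) d(1) unfolding continuous_at_eps_delta by (auto simp: dist_real_def)
  obtain e where e: "e > 0" "\<And>t::real. \<bar>t\<bar> < e \<Longrightarrow> \<bar>ln (1 + t)\<bar> < \<eta>"
    using cont(2) \<eta>(1) unfolding continuous_at_eps_delta by (auto simp: dist_real_def)
  \<comment> \<open>The transforms of the first \<open>N\<close> laws may be infinite on part of the interval, hence the shift.\<close>
  obtain M where M: "real_distribution M" and conv: "weak_conv_m (\<lambda>n. FT (n + N) \<mu>) M"
    and mgf: "\<And>u. \<bar>u\<bar> < \<eta> \<Longrightarrow> integrable M (\<lambda>x. exp (u * x)) \<and>
      (\<integral>x. exp (u * x) \<partial>M) = exp (K (exp u - 1))"
  proof (rule mgf_continuity[of "\<lambda>n. FT (n + N) \<mu>" \<eta> "\<lambda>u. exp (K (exp u - 1))"])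
    show "real_distribution (FT (n + N) \<mu>)" for n
      using fcgf[of "n + N"] by (simp add: has_fcgf_def)
    fix u :: real assume "\<bar>u\<bar> < \<eta>"
    then have u: "\<bar>exp u - 1\<bar> < d" by (rule \<eta>(2))
    have 1: "exp u - 1 \<in> fcgf_dom (FT (n + N) \<mu>)"
      "exp (tilt (C (n + N)) (\<theta> (n + N)) (exp u - 1)) = (\<integral>x. exp (u * x) \<partial>FT (n + N) \<mu>)" for n
      using near[OF _ _ N[of "n + N"] u] by auto
    show "integrable (FT (n + N) \<mu>) (\<lambda>x. exp (u * x))" for n
      using 1(1)[of n] by (simp add: mem_fcgf_dom_iff)
    show "(\<lambda>n. \<integral>x. exp (u * x) \<partial>FT (n + N) \<mu>) \<longlonglongrightarrow> exp (K (exp u - 1))"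
      unfolding 1(2)[symmetric] by (intro tendsto_exp LIMSEQ_ignore_initial_segment lim u)
  qed (use \<eta>(1) in auto)
  have "weak_conv_m (\<lambda>n. FT n \<mu>) M"
    unfolding weak_conv_m_def weak_conv_def
  proof (intro allI impI)
    fix x assume "isCont (cdf M) x"
    then have "(\<lambda>n. cdf (FT (n + N) \<mu>) x) \<longlonglongrightarrow> cdf M x"
      using conv by (simp add: weak_conv_m_def weak_conv_def)
    then show "(\<lambda>n. cdf (FT n \<mu>) x) \<longlonglongrightarrow> cdf M x" by (rule LIMSEQ_offset)
  qed
  moreover have "t \<in> fcgf_dom M \<and> exp (K t) = (\<integral>x. exp (ln (1 + t) * x) \<partial>M)"
    if "\<bar>t\<bar> < min e 1" for t
    using mgf[OF e(2)[of t]] that by (auto simp: mem_fcgf_dom_iff)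
  ultimately show ?thesis
    using M e(1) by (intro that[of M "min e 1"]) auto
qed

section \<open>Vanishing limit dispersion\<close>

text \<open>The weights \<open>e\<^bsup>-h\<^esup>\<close> and \<open>e\<^sup>h\<close> with \<open>h = (A - B) / 2\<close> make the two integrals equal, and
  the inequality \<open>e\<^sup>y + e\<^bsup>-y\<^esup> \<ge> 2\<close> is then integrated with \<open>y = s * x - h\<close>.\<close>

lemma log_mgf_add_reflected_nonneg:
  assumes "real_distribution M" "integrable M (\<lambda>x. exp (s * x))" "integrable M (\<lambda>x. exp (- s * x))"
    and A: "(\<integral>x. exp (s * x) \<partial>M) = exp A" and B: "(\<integral>x. exp (- s * x) \<partial>M) = exp B"
  shows "A + B \<ge> 0"
proof -
  interpret real_distribution M by fact
  define h where "h = (A - B) / 2"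
  have "2 \<le> (\<integral>x. exp (- h) * exp (s * x) + exp h * exp (- s * x) \<partial>M)"
  proof -
    have "2 \<le> exp (- h) * exp (s * x) + exp h * exp (- s * x)" for x
    proof -
      have "exp (- h) * exp (s * x) = exp (s * x - h)" "exp h * exp (- s * x) = exp (h - s * x)"
        by (simp_all flip: exp_add)
      then show ?thesis
        using exp_ge_add_one_self[of "s * x - h"] exp_ge_add_one_self[of "h - s * x"] by linarith
    qed
    moreover have "integrable M (\<lambda>x. exp (- h) * exp (s * x) + exp h * exp (- s * x))"
      using assms(2,3) by auto
    ultimately have "(\<integral>x. 2 \<partial>M) \<le> (\<integral>x. exp (- h) * exp (s * x) + exp h * exp (- s * x) \<partial>M)"
      by (intro integral_mono) auto
    then show ?thesis by (simp add: prob_space[simplified])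
  qed
  also have "\<dots> = exp (- h) * exp A + exp h * exp B"
    using assms(2,3) by (simp flip: A B)
  also have "\<dots> = 2 * exp ((A + B) / 2)"
    by (simp add: h_def field_simps flip: exp_add)
  finally show ?thesis by simp
qed

lemma poisson_law_mgf:
  assumes "\<mu> \<ge> 0"
  shows "real_distribution (poisson_law \<mu>)" "integrable (poisson_law \<mu>) (\<lambda>x. exp (s * x))"
    "(\<integral>x. exp (s * x) \<partial>poisson_law \<mu>) = exp (\<mu> * (exp s - 1))"
proof -
  let ?p = "if \<mu> = 0 then return_pmf 0 else poisson_pmf \<mu>"
  show "real_distribution (poisson_law \<mu>)"
    unfolding poisson_law_def by (intro prob_space.real_distribution_distr prob_space_measure_pmf) simp
  have "integrable ?p (\<lambda>k. exp (s * real k)) \<and> (\<integral>k. exp (s * real k) \<partial>?p) = exp (\<mu> * (exp s - 1))"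
  proof (cases "\<mu> = 0")
    case False
    then have pos: "\<mu> > 0" using assms by simp
    have "(\<lambda>k. exp (- \<mu>) * ((\<mu> * exp s) ^ k /\<^sub>R fact k)) sums (exp (- \<mu>) * exp (\<mu> * exp s))"
      by (intro sums_mult exp_converges)
    also have "(\<lambda>k. exp (- \<mu>) * ((\<mu> * exp s) ^ k /\<^sub>R fact k)) = (\<lambda>k. pmf (poisson_pmf \<mu>) k * exp (s * real k))"
      using pos by (auto simp: power_mult_distrib divide_simps mult.commute simp flip: exp_of_nat_mult)
    also have "exp (- \<mu>) * exp (\<mu> * exp s) = exp (\<mu> * (exp s - 1))"
      by (simp add: algebra_simps flip: exp_add)
    finally have sums: "(\<lambda>k. pmf (poisson_pmf \<mu>) k * exp (s * real k)) sums exp (\<mu> * (exp s - 1))" .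
    have "(\<integral>\<^sup>+k. ennreal (exp (s * real k)) \<partial>poisson_pmf \<mu>)
        = (\<Sum>k. ennreal (pmf (poisson_pmf \<mu>) k * exp (s * real k)))"
      by (subst nn_integral_measure_pmf, subst nn_integral_count_space_nat) (simp add: ennreal_mult)
    also have "\<dots> = ennreal (exp (\<mu> * (exp s - 1)))"
      by (intro suminf_ennreal_eq sums) simp
    finally have "(\<integral>\<^sup>+k. ennreal (exp (s * real k)) \<partial>poisson_pmf \<mu>) = ennreal (exp (\<mu> * (exp s - 1)))" .
    then have "integrable (poisson_pmf \<mu>) (\<lambda>k. exp (s * real k)) \<and>
        (\<integral>k. exp (s * real k) \<partial>poisson_pmf \<mu>) = exp (\<mu> * (exp s - 1))"
      by (subst (asm) nn_integral_eq_integrable) auto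
    then show ?thesis using False by simp
  qed (simp add: integrable_measure_pmf_finite)
  then show "integrable (poisson_law \<mu>) (\<lambda>x. exp (s * x))"
    "(\<integral>x. exp (s * x) \<partial>poisson_law \<mu>) = exp (\<mu> * (exp s - 1))"
    unfolding poisson_law_def by (simp_all add: integrable_distr_eq integral_distr)
qed

lemma inner_interval:
  fixes S :: "real set"
  assumes "open S" "is_interval S" "\<mu> \<in> S"
  obtains a b where "a < \<mu>" "\<mu> < b" "{a..b} \<subseteq> S"
proof -
  obtain e where e: "e > 0" "cball \<mu> e \<subseteq> S" using assms open_contains_cball by blast
  then have "{\<mu> - e..\<mu> + e} \<subseteq> S" by (simp add: cball_eq_atLeastAtMost)
  then show ?thesis using e(1) by (intro that[of "\<mu> - e" "\<mu> + e"]) auto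
qed

text \<open>The limit law has FCGF \<open>\<mu> t\<close>, hence Laplace transform \<open>exp (\<mu> * (exp s - 1))\<close>.  That \<open>\<mu>\<close> is
  nonnegative follows from the product of the transforms at \<open>s\<close> and \<open>-s\<close> being at least one, as
  \<open>exp s + exp (- s) > 2\<close>.\<close>

lemma weak_limit_poisson:
  assumes fam: "\<And>n. local_tilting_family (FT n) (\<Psi> n) (vn n)"
    and ab: "a < \<mu>" "\<mu> < b" "\<And>n. {a..b} \<subseteq> \<Psi> n"
    and unif: "uniform_limit {a..b} vn (\<lambda>_. 0) sequentially"
  shows "0 \<le> \<mu> \<and> weak_conv_m (\<lambda>n. FT n \<mu>) (poisson_law \<mu>)"
proof -
  obtain M e where M: "real_distribution M" and conv: "weak_conv_m (\<lambda>n. FT n \<mu>) M" and e: "e > 0"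
    and mgf: "\<And>t. \<bar>t\<bar> < e \<Longrightarrow> t \<in> fcgf_dom M \<and> exp (\<mu> * t) = (\<integral>x. exp (ln (1 + t) * x) \<partial>M)"
  proof (rule tilting_families_weak_limit[OF fam ab, where \<psi> = "\<lambda>m. m" and \<psi>' = "\<lambda>_. 1" and c = 0
        and L = 1 and ?d0.0 = 1 and X = "\<lambda>_. \<mu>" and K = "\<lambda>t. \<mu> * t"])
    show "uniform_limit {a..b} (\<lambda>n m. 1 * vn n m) (\<lambda>_. 0) sequentially" using unif by simp
  qed (use ab in \<open>auto intro!: derivative_eq_intros\<close>)
  have "isCont (\<lambda>s::real. exp s - 1) 0" by (intro continuous_intros)
  then obtain \<eta> where \<eta>: "\<eta> > 0" "\<And>s::real. \<bar>s\<bar> < \<eta> \<Longrightarrow> \<bar>exp s - 1\<bar> < e"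
    using e unfolding continuous_at_eps_delta by (auto simp: dist_real_def)
  have mgf': "integrable M (\<lambda>x. exp (s * x)) \<and> (\<integral>x. exp (s * x) \<partial>M) = exp (\<mu> * (exp s - 1))"
    if "\<bar>s\<bar> < \<eta>" for s
    using mgf[OF \<eta>(2)[OF that]] by (simp add: mem_fcgf_dom_iff)
  define s where "s = \<eta> / 2"
  have s: "s > 0" "\<bar>s\<bar> < \<eta>" "\<bar>- s\<bar> < \<eta>" using \<eta>(1) by (auto simp: s_def)
  have "\<mu> * (exp s - 1) + \<mu> * (exp (- s) - 1) \<ge> 0"
    by (rule log_mgf_add_reflected_nonneg[OF M]) (use mgf'[OF s(2)] mgf'[OF s(3)] in auto)
  also have "\<mu> * (exp s - 1) + \<mu> * (exp (- s) - 1) = \<mu> * ((exp (s / 2) - exp (- (s / 2)))\<^sup>2)"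
    by (simp add: power2_eq_square algebra_simps flip: exp_add)
  finally have "0 \<le> \<mu> * ((exp (s / 2) - exp (- (s / 2)))\<^sup>2)" .
  moreover have "(exp (s / 2) - exp (- (s / 2)))\<^sup>2 > 0" using s(1) by simp
  ultimately have \<mu>: "\<mu> \<ge> 0" by (simp add: zero_le_mult_iff)
  have "M = poisson_law \<mu>"
    by (rule real_distribution_eq_if_mgf_eq[OF M poisson_law_mgf(1)[OF \<mu>] \<eta>(1)])
      (use mgf' poisson_law_mgf[OF \<mu>] in auto)
  then show ?thesis using \<mu> conv by simp
qed

section \<open>Nonvanishing limit dispersion\<close>

lemma antiderivative_on_open_interval:
  fixes f :: "real \<Rightarrow> real"
  assumes S: "open S" "is_interval S" "x0 \<in> S" and f: "continuous_on S f"
  obtains F where "\<And>x. x \<in> S \<Longrightarrow> (F has_real_derivative f x) (at x)" "F x0 = 0"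
proof -
  define a b where "a = (INF x\<in>S. ereal x)" and "b = (SUP x\<in>S. ereal x)"
  have mem: "x \<in> S \<longleftrightarrow> a < ereal x \<and> ereal x < b" for x
  proof
    assume "x \<in> S"
    then obtain e where e: "e > 0" "ball x e \<subseteq> S" using S(1) open_contains_ball by blast
    then have "x - e / 2 \<in> S" "x + e / 2 \<in> S" by (auto simp: subset_eq dist_real_def)
    then have "a \<le> ereal (x - e / 2)" "ereal (x + e / 2) \<le> b"
      unfolding a_def b_def by (auto intro: INF_lower SUP_upper)
    moreover have "ereal (x - e / 2) < ereal x" "ereal x < ereal (x + e / 2)" using e(1) by auto
    ultimately show "a < ereal x \<and> ereal x < b" by (meson le_less_trans less_le_trans)
  next
    assume "a < ereal x \<and> ereal x < b"
    then obtain y z where "y \<in> S" "y < x" "z \<in> S" "x < z"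
      unfolding a_def b_def INF_less_iff less_SUP_iff by auto
    then show "x \<in> S" using mem_is_interval_1_I[OF S(2), of y z x] by simp
  qed
  have "\<exists>F. \<forall>x. a < ereal x \<longrightarrow> ereal x < b \<longrightarrow> (F has_vector_derivative f x) (at x)"
  proof (rule einterval_antiderivative)
    show "a < b" using mem[of x0] S(3) by auto
    show "isCont f x" if "a < ereal x" "ereal x < b" for x
      using mem[of x] that f S(1) by (simp add: continuous_on_eq_continuous_at)
  qed
  then obtain F where F: "\<And>x. x \<in> S \<Longrightarrow> (F has_real_derivative f x) (at x)"
    using mem by (auto simp: has_real_derivative_iff_has_vector_derivative)
  have "((\<lambda>x. F x - F x0) has_real_derivative f x) (at x)" if "x \<in> S" for x
    using F[OF that] by (auto intro!: derivative_eq_intros)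
  then show ?thesis by (intro that[of "\<lambda>x. F x - F x0"]) auto
qed

text \<open>With \<open>\<psi>\<close> an antiderivative of \<open>1 / v\<close> and \<open>g = \<psi>\<^sup>-\<^sup>1\<close>, the generating function \<open>C\<close> of the limit
  family is an antiderivative of \<open>g\<close>, so that \<open>C' = g\<close>, \<open>C'' = v \<circ> g\<close> and the mean \<open>\<mu>\<close> belongs to the
  parameter \<open>\<psi> \<mu>\<close>.  The weak limit for each \<open>\<mu>\<close> has the FCGF \<open>tilt C (\<psi> \<mu>)\<close>, which makes \<open>C\<close>
  analytic at every parameter and all its tiltings FCGFs.\<close>

lemma weak_limit_dispersed_family:
  assumes fam: "\<And>n. local_tilting_family (FT n) (\<Psi> n) (vn n)"
    and S: "open S" "is_interval S" "S \<noteq> {}" "\<And>n. S \<subseteq> \<Psi> n"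
    and unif: "\<And>T. compact T \<Longrightarrow> T \<subseteq> S \<Longrightarrow> uniform_limit T vn v sequentially"
    and v0: "\<And>\<mu>. \<mu> \<in> S \<Longrightarrow> v \<mu> \<noteq> 0"
  obtains FT' where "local_tilting_family FT' S v" "\<And>\<mu>. \<mu> \<in> S \<Longrightarrow> weak_conv_m (\<lambda>n. FT n \<mu>) (FT' \<mu>)"
proof -
  obtain x0 where x0: "x0 \<in> S" using S(3) by blast
  have v_cont_on: "continuous_on {a..b} v" if "{a..b} \<subseteq> S" for a b
  proof (rule uniform_limit_theorem[OF _ unif[OF _ that] sequentially_bot])
    show "\<forall>\<^sub>F n in sequentially. continuous_on {a..b} (vn n)"
      using that S(4) by (intro always_eventually allI local_dispersion_continuous[OF fam]) blast
  qed simp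
  have "isCont v \<mu>" if \<mu>: "\<mu> \<in> S" for \<mu>
  proof -
    obtain a b where ab: "a < \<mu>" "\<mu> < b" "{a..b} \<subseteq> S" using inner_interval[OF S(1,2) \<mu>] .
    show ?thesis using continuous_on_interior[OF v_cont_on[OF ab(3)]] ab(1,2) by simp
  qed
  then have v_cont: "continuous_on S v" by (intro continuous_at_imp_continuous_on) blast
  have sign: "(\<forall>\<mu>\<in>S. v \<mu> > 0) \<or> (\<forall>\<mu>\<in>S. v \<mu> < 0)"
  proof (rule ccontr)
    assume "\<not> ?thesis"
    then obtain x y where "x \<in> S" "y \<in> S" "v x < 0" "v y > 0" using v0 by (metis linorder_neqE_linordered_idom)
    moreover have "connected (v ` S)"
      using S(2) v_cont by (intro connected_continuous_image is_interval_connected)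
    ultimately have "0 \<in> v ` S" using connectedD_interval[of "v ` S" "v x" "v y" 0] by simp
    then show False using v0 by auto
  qed
  have "continuous_on S (\<lambda>m. 1 / v m)" using v_cont v0 by (intro continuous_intros) auto
  then obtain \<psi> where \<psi>: "\<And>m. m \<in> S \<Longrightarrow> (\<psi> has_real_derivative 1 / v m) (at m)" "\<psi> x0 = 0"
    using antiderivative_on_open_interval[OF S(1,2) x0] by metis
  have \<psi>_cont: "continuous_on S \<psi>"
    using \<psi>(1) by (intro continuous_at_imp_continuous_on ballI DERIV_isCont) auto
  \<comment> \<open>The slope \<open>1 / v\<close> of \<open>\<psi>\<close> is at least \<open>1 / L\<close> in modulus.\<close>
  have \<psi>_lip: "\<bar>m - m'\<bar> \<le> L * \<bar>\<psi> m - \<psi> m'\<bar>"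
    if ab: "{a..b} \<subseteq> S" and L: "\<And>m. m \<in> {a..b} \<Longrightarrow> \<bar>v m\<bar> \<le> L" and m: "m \<in> {a..b}" "m' \<in> {a..b}"
    for a b L m m'
  proof -
    have *: "\<bar>y - x\<bar> \<le> L * \<bar>\<psi> y - \<psi> x\<bar>" if xy: "a \<le> x" "x < y" "y \<le> b" for x y
    proof -
      obtain z where z: "x < z" "z < y" "\<psi> y - \<psi> x = (y - x) * (1 / v z)"
        using MVT2[OF xy(2), of \<psi> "\<lambda>z. 1 / v z"] \<psi>(1) ab xy by (auto simp: subset_eq)
      have "z \<in> {a..b}" using z xy by auto
      then have "v z \<noteq> 0" "\<bar>v z\<bar> \<le> L" using v0 ab L by auto
      have "\<bar>y - x\<bar> = \<bar>v z\<bar> * \<bar>\<psi> y - \<psi> x\<bar>"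
        unfolding z(3) using \<open>v z \<noteq> 0\<close> by (simp add: abs_mult)
      also have "\<dots> \<le> L * \<bar>\<psi> y - \<psi> x\<bar>" using \<open>\<bar>v z\<bar> \<le> L\<close> by (intro mult_right_mono) auto
      finally show ?thesis .
    qed
    show ?thesis
      using *[of m m'] *[of m' m] m by (cases m m' rule: linorder_cases) (auto simp: abs_minus_commute)
  qed
  have bounded_v: "\<exists>L. L \<ge> 0 \<and> (\<forall>m\<in>{a..b}. \<bar>v m\<bar> \<le> L)" if "{a..b} \<subseteq> S" for a b
  proof -
    have "bounded (v ` {a..b})"
      by (intro compact_imp_bounded compact_continuous_image v_cont_on that) simp
    then obtain L where "\<forall>m\<in>{a..b}. \<bar>v m\<bar> \<le> L" by (auto simp: bounded_iff)
    then show ?thesis by (intro exI[of _ "max L 0"]) (auto simp: le_max_iff_disj)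
  qed
  have \<psi>_inj: "inj_on \<psi> S"
  proof (rule inj_onI)
    fix x y assume xy: "x \<in> S" "y \<in> S" "\<psi> x = \<psi> y"
    have sub: "{min x y..max x y} \<subseteq> S"
      using mem_is_interval_1_I[OF S(2), of "min x y" "max x y"] xy by (auto simp: min_def max_def)
    obtain L where L: "\<forall>m\<in>{min x y..max x y}. \<bar>v m\<bar> \<le> L" using bounded_v[OF sub] by blast
    show "x = y" using \<psi>_lip[OF sub, of L x y] L xy(3) by auto
  qed
  define \<Theta> where "\<Theta> = \<psi> ` S"
  define g where "g = the_inv_into S \<psi>"
  have g: "g (\<psi> m) = m" if "m \<in> S" for m unfolding g_def by (rule the_inv_into_f_f[OF \<psi>_inj that])
  have g_in: "g \<theta> \<in> S" "\<psi> (g \<theta>) = \<theta>" if "\<theta> \<in> \<Theta>" for \<theta> using that g by (auto simp: \<Theta>_def)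
  have \<Theta>_open: "open \<Theta>" unfolding \<Theta>_def by (rule invariance_of_domain[OF \<psi>_cont S(1) \<psi>_inj])
  have \<Theta>_int: "is_interval \<Theta>"
    unfolding is_interval_connected_1 \<Theta>_def
    using S(2) by (intro connected_continuous_image \<psi>_cont is_interval_connected)
  have zero: "0 \<in> \<Theta>" using x0 \<psi>(2) by (force simp: \<Theta>_def)
  have g_deriv: "(g has_real_derivative v (g \<theta>)) (at \<theta>)" if \<theta>: "\<theta> \<in> \<Theta>" for \<theta>
  proof -
    have "(g has_derivative (*) (v (g \<theta>))) (at (\<psi> (g \<theta>)))"
    proof (rule has_derivative_inverse_strong[OF S(1) g_in(1)[OF \<theta>] \<psi>_cont g])
      show "(\<psi> has_derivative (*) (1 / v (g \<theta>))) (at (g \<theta>))"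
        using \<psi>(1)[OF g_in(1)[OF \<theta>]] by (simp only: has_field_derivative_def)
      show "(*) (1 / v (g \<theta>)) \<circ> (*) (v (g \<theta>)) = id"
        using v0[OF g_in(1)[OF \<theta>]] by auto
    qed
    then show ?thesis by (simp add: g_in(2)[OF \<theta>] has_field_derivative_def)
  qed
  have g_cont: "continuous_on \<Theta> g"
    using g_deriv by (intro continuous_at_imp_continuous_on ballI DERIV_isCont) auto
  obtain C where C: "\<And>\<theta>. \<theta> \<in> \<Theta> \<Longrightarrow> (C has_real_derivative g \<theta>) (at \<theta>)" "C 0 = 0"
    using antiderivative_on_open_interval[OF \<Theta>_open \<Theta>_int zero g_cont] by metis
  have "\<exists>M. weak_conv_m (\<lambda>n. FT n \<mu>) M \<and> has_fcgf M (tilt C (\<psi> \<mu>)) \<and> real_analytic_at (tilt C (\<psi> \<mu>)) 0"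
    if \<mu>: "\<mu> \<in> S" for \<mu>
  proof -
    obtain a b where ab: "a < \<mu>" "\<mu> < b" "{a..b} \<subseteq> S" using inner_interval[OF S(1,2) \<mu>] .
    obtain L where L: "L \<ge> 0" "\<forall>m\<in>{a..b}. \<bar>v m\<bar> \<le> L" using bounded_v[OF ab(3)] by blast
    let ?\<theta> = "\<psi> \<mu>"
    have \<theta>: "?\<theta> \<in> \<Theta>" using \<mu> by (simp add: \<Theta>_def)
    have "open (\<Theta> \<inter> g -` {a<..<b})"
      by (intro continuous_open_preimage g_cont \<Theta>_open) simp
    moreover have "?\<theta> \<in> \<Theta> \<inter> g -` {a<..<b}" using \<theta> ab(1,2) by (simp add: g[OF \<mu>])
    ultimately obtain d where d: "d > 0" "ball ?\<theta> d \<subseteq> \<Theta> \<inter> g -` {a<..<b}"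
      using open_contains_ball by blast
    have near: "?\<theta> + t \<in> \<Theta> \<and> g (?\<theta> + t) \<in> {a..b}" if "\<bar>t\<bar> < d" for t
    proof -
      have "?\<theta> + t \<in> ball ?\<theta> d" using that by (simp add: dist_real_def)
      then have "?\<theta> + t \<in> \<Theta> \<inter> g -` {a<..<b}" using d(2) by blast
      then show ?thesis by simp
    qed
    \<comment> \<open>\<open>1 / v\<close> is bounded on \<open>[a, b]\<close> because the continuous \<open>v\<close> has no zero there.\<close>
    have unif1: "uniform_limit {a..b} (\<lambda>n m. 1 / v m * vn n m) (\<lambda>_. 1) sequentially"
    proof -
      have "uniform_limit {a..b} (\<lambda>n m. 1 / v m * vn n m) (\<lambda>m. 1 / v m * v m) sequentially"
      proof (rule uniform_lim_mult[OF uniform_limit_const unif[OF _ ab(3)]])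
        show "bounded ((\<lambda>m. 1 / v m) ` {a..b})"
          using v0 ab(3) by (intro compact_imp_bounded compact_continuous_image continuous_intros v_cont_on ab(3)) auto
        show "bounded (v ` {a..b})"
          by (intro compact_imp_bounded compact_continuous_image v_cont_on ab(3)) simp
      qed simp
      then show ?thesis
        by (rule uniform_limit_cong'[THEN iffD1, rotated -1]) (use v0 ab(3) in auto)
    qed
    obtain M e where M: "real_distribution M" and conv: "weak_conv_m (\<lambda>n. FT n \<mu>) M" and e: "e > 0"
      and mgf: "\<And>t. \<bar>t\<bar> < e \<Longrightarrow> t \<in> fcgf_dom M \<and> exp (tilt C ?\<theta> t) = (\<integral>x. exp (ln (1 + t) * x) \<partial>M)"
    proof (rule tilting_families_weak_limit[OF fam ab(1,2) _ _ unif1 _ L(1), where \<psi> = \<psi>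
          and ?d0.0 = d and X = "\<lambda>t. g (?\<theta> + t)" and K = "tilt C ?\<theta>"])
      show "{a..b} \<subseteq> \<Psi> n" for n using ab(3) S(4) by blast
      show "(\<psi> has_real_derivative 1 / v m) (at m)" if "m \<in> {a..b}" for m
        using that ab(3) by (intro \<psi>(1)) auto
      show "\<bar>m - m'\<bar> \<le> L * \<bar>\<psi> m - \<psi> m'\<bar>" if "m \<in> {a..b}" "m' \<in> {a..b}" for m m'
        using \<psi>_lip[OF ab(3) _ that] L(2) by blast
      show "g (?\<theta> + t) \<in> {a..b} \<and> \<psi> (g (?\<theta> + t)) = \<psi> \<mu> + 1 * t" if "\<bar>t\<bar> < d" for t
        using near[OF that] g_in(2) by simp
      show "(tilt C ?\<theta> has_real_derivative g (?\<theta> + t)) (at t)" if "\<bar>t\<bar> < d" for t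
      proof -
        have "(C has_real_derivative g (?\<theta> + t)) (at (t + ?\<theta>))"
          using near[OF that] C(1)[of "?\<theta> + t"] by (simp add: add.commute)
        then have "((\<lambda>u. C (?\<theta> + u)) has_real_derivative g (?\<theta> + t)) (at t)"
          unfolding DERIV_shift by (simp add: add.commute)
        then show ?thesis unfolding tilt_def[abs_def] by (auto intro!: derivative_eq_intros)
      qed
    qed (use d(1) in \<open>auto simp: tilt_def\<close>)
    have "has_fcgf M (tilt C ?\<theta>)" "real_analytic_at (tilt C ?\<theta>) 0"
      using has_fcgfI[OF M e mgf] fcgf_real_analytic_at_zero[OF M e mgf] by auto
    with conv show ?thesis by blast
  qed
  then obtain FT' where FT': "\<And>\<mu>. \<mu> \<in> S \<Longrightarrow> weak_conv_m (\<lambda>n. FT n \<mu>) (FT' \<mu>)"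
      "\<And>\<mu>. \<mu> \<in> S \<Longrightarrow> has_fcgf (FT' \<mu>) (tilt C (\<psi> \<mu>))"
      "\<And>\<mu>. \<mu> \<in> S \<Longrightarrow> real_analytic_at (tilt C (\<psi> \<mu>)) 0"
    by metis
  have tilt_fcgfs: "tilt C \<theta> \<in> fcgfs" if \<theta>: "\<theta> \<in> \<Theta>" for \<theta>
  proof -
    obtain \<mu> where \<mu>: "\<mu> \<in> S" "\<theta> = \<psi> \<mu>" using \<theta> by (auto simp: \<Theta>_def)
    then have "tilt C \<theta> \<in> analytic_funs"
      using FT'(3) by (intro analytic_funs_if_analytic_at_zero) (auto simp: tilt_def)
    then show ?thesis using FT'(2) \<mu> by (auto simp: fcgfs_def)
  qed
  have tilt_0: "tilt C 0 = C" using C(2) by (simp add: tilt_def[abs_def])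
  have "analytic_interval C \<Theta>"
  proof (rule analytic_interval_open[OF \<Theta>_open \<Theta>_int zero])
    show "real_analytic_at C \<theta>" if "\<theta> \<in> \<Theta>" for \<theta>
      by (rule real_analytic_at_if_tilt) (use that FT'(3) in \<open>auto simp: \<Theta>_def\<close>)
  qed
  then have \<Theta>_dom: "\<Theta> \<subseteq> analytic_dom C" by (rule analytic_interval_subset_dom)
  have deriv_C: "deriv C \<theta> = g \<theta>" if "\<theta> \<in> \<Theta>" for \<theta> using C(1)[OF that] by (rule DERIV_imp_deriv)
  have deriv2_C: "deriv (deriv C) \<theta> = v (g \<theta>)" if \<theta>: "\<theta> \<in> \<Theta>" for \<theta>
  proof -
    have "\<forall>\<^sub>F s in nhds \<theta>. deriv C s = g s"
      using eventually_nhds_in_open[OF \<Theta>_open \<theta>] by eventually_elim (rule deriv_C)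
    then show ?thesis
      using g_deriv[OF \<theta>] by (simp add: DERIV_imp_deriv cong: deriv_cong_ev)
  qed
  have "locally_dispersed C \<Theta> g (\<lambda>\<theta>. v (g \<theta>))"
    unfolding locally_dispersed_def
  proof (intro conjI)
    show "continuous_on \<Theta> (\<lambda>\<theta>. v (g \<theta>))"
      by (rule continuous_on_compose2[OF v_cont g_cont]) (use g_in in auto)
    show "(\<forall>\<theta>\<in>\<Theta>. v (g \<theta>) > 0) \<or> (\<forall>\<theta>\<in>\<Theta>. v (g \<theta>) < 0)" using sign g_in(1) by blast
  qed (use \<Theta>_int \<Theta>_dom g_cont zero deriv_C deriv2_C in \<open>auto simp: interior_open[OF \<Theta>_open]\<close>)
  moreover have "S = g ` \<Theta>" using g by (force simp: \<Theta>_def)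
  moreover have "C \<in> fcgfs" using tilt_fcgfs[OF zero] tilt_0 by simp
  moreover have "tilt C \<theta> \<in> tilting_family C \<and> has_fcgf (FT' (g \<theta>)) (tilt C \<theta>)" if "\<theta> \<in> \<Theta>" for \<theta>
    using that tilt_fcgfs[OF that] \<Theta>_dom FT'(2)[OF g_in(1)[OF that]] g_in(2)[OF that]
    by (auto simp: tilting_family_def)
  ultimately have "local_tilting_family FT' S v" unfolding local_tilting_family_def by blast
  then show ?thesis using FT'(1) that by blast
qed

theorem theorem4p1:
  fixes FT :: "nat \<Rightarrow> real \<Rightarrow> real measure"
    and \<Psi> :: "nat \<Rightarrow> real set"
    and vn :: "nat \<Rightarrow> real \<Rightarrow> real"
    and \<Psi>0 :: "real set"
    and v :: "real \<Rightarrow> real"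
  assumes "\<And>n. local_tilting_family (FT n) (\<Psi> n) (vn n)"
    and "is_interval \<Psi>0" and "\<Psi>0 \<noteq> {}" and "\<Psi>0 \<subseteq> (\<Inter>n. \<Psi> n)"
    and "\<And>S. compact S \<Longrightarrow> S \<subseteq> interior \<Psi>0 \<Longrightarrow> uniform_limit S vn v sequentially"
    and "(\<forall>\<mu> \<in> interior \<Psi>0. v \<mu> \<noteq> 0) \<or> (\<forall>\<mu> \<in> interior \<Psi>0. v \<mu> = 0)"
  shows "((\<forall>\<mu> \<in> interior \<Psi>0. v \<mu> \<noteq> 0) \<longrightarrow>
            (\<exists>FT' \<Psi>' v'. local_tilting_family FT' \<Psi>' v' \<and> interior \<Psi>0 \<subseteq> \<Psi>' \<and>
               (\<forall>\<mu> \<in> interior \<Psi>0. v' \<mu> = v \<mu>) \<and>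
               (\<forall>\<mu> \<in> interior \<Psi>0. weak_conv_m (\<lambda>n. FT n \<mu>) (FT' \<mu>)))) \<and>
         ((\<forall>\<mu> \<in> interior \<Psi>0. v \<mu> = 0) \<longrightarrow>
            (\<forall>\<mu> \<in> interior \<Psi>0. 0 \<le> \<mu> \<and> weak_conv_m (\<lambda>n. FT n \<mu>) (poisson_law \<mu>)))"
proof (intro conjI impI ballI)
  let ?S = "interior \<Psi>0"
  have S: "open ?S" "is_interval ?S"
    using assms(2) by (auto simp: is_interval_convex_1 convex_interior)
  have sub: "?S \<subseteq> \<Psi> n" for n using interior_subset[of \<Psi>0] assms(4) by blast
  {
    assume v0: "\<forall>\<mu> \<in> ?S. v \<mu> \<noteq> 0"
    show "\<exists>FT' \<Psi>' v'. local_tilting_family FT' \<Psi>' v' \<and> ?S \<subseteq> \<Psi>' \<and> (\<forall>\<mu> \<in> ?S. v' \<mu> = v \<mu>) \<and>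
        (\<forall>\<mu> \<in> ?S. weak_conv_m (\<lambda>n. FT n \<mu>) (FT' \<mu>))"
    proof (cases "?S = {}")
      case True
      \<comment> \<open>\<open>\<Psi>0\<close> is a single point and any family will do.\<close>
      then show ?thesis using assms(1)[of 0] by blast
    next
      case False
      obtain FT' where "local_tilting_family FT' ?S v" "\<And>\<mu>. \<mu> \<in> ?S \<Longrightarrow> weak_conv_m (\<lambda>n. FT n \<mu>) (FT' \<mu>)"
        by (rule weak_limit_dispersed_family[OF assms(1) S False sub assms(5)]) (use v0 in auto)
      then show ?thesis by blast
    qed
  next
    fix \<mu> assume v0: "\<forall>\<mu> \<in> ?S. v \<mu> = 0" and \<mu>: "\<mu> \<in> ?S"
    obtain a b where ab: "a < \<mu>" "\<mu> < b" "{a..b} \<subseteq> ?S" using inner_interval[OF S \<mu>] .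
    have "uniform_limit {a..b} vn (\<lambda>_. 0) sequentially"
      by (rule uniform_limit_cong'[THEN iffD1, OF _ _ assms(5)[OF _ ab(3)]]) (use v0 ab(3) in auto)
    then have "0 \<le> \<mu> \<and> weak_conv_m (\<lambda>n. FT n \<mu>) (poisson_law \<mu>)"
      using ab sub by (intro weak_limit_poisson[OF assms(1)]) blast+
    then show "0 \<le> \<mu>" "weak_conv_m (\<lambda>n. FT n \<mu>) (poisson_law \<mu>)" by auto
  }
qed

end
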